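(* Let $r_1,r_2,s_1,s_2\in[1,\infty]$ be such that, for each $j\in\{1,2\}$, one of the following holds: $r_j=s_j=1$; or $r_j\in(1,\infty)$ and $s_j\in[1,\infty]$; or $r_j=s_j=\infty$. Let $1<p<q$ and $r=\frac{q}{q-p}$, and let $$R_{p,q}g(t)=\Big(\frac1t\int_0^{t^{r}}g^*(s)^p\,ds\Big)^{\frac1p},\quad t\in(0,\infty),\ g\in\mathfrak{M}(0,\infty).$$ Then $R_{p,q}$ is bounded from $L^{r_1,s_1}(0,\infty)$ to $L^{r_2,s_2}(0,\infty)$ if and only if one of the following conditions holds: (1) $r_1\in(p,q)$, $s_1\le s_2$, and $\frac1q+\frac1{r\,r_2}=\frac1{r_1}$; or (2) $r_1=p$, $r_2=p$, $s_1\le p$, and $s_2=\infty$; or (3) $r_1=q$, $r_2=\infty$, and $s_2=\infty$.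
   Context: $\mathfrak{M}(0,\infty)$ is the set of Lebesgue measurable functions on $(0,\infty)$; $g^*(t)=\inf\{\lambda>0:|\{|g|>\lambda\}|\le t\}$ is the nonincreasing rearrangement. The Lorentz space $L^{a,b}(0,\infty)$ is given by the functional $\|g\|_{L^{a,b}(0,\infty)}=\|t^{\frac1a-\frac1b}g^*(t)\|_{L^b(0,\infty)}$ (with $1/\infty=0$). Bounded means $\|R_{p,q}g\|_{L^{r_2,s_2}(0,\infty)}\le C\|g\|_{L^{r_1,s_1}(0,\infty)}$ for all $g\in\mathfrak{M}(0,\infty)$ with a constant $C$ independent of $g$. *)

theory Defs
  imports "HOL-Analysis.Analysis" "HOL-Probability.Essential_Supremum"
begin

abbreviation halfline :: "real measure" where
  "halfline \<equiv> lebesgue_on {0<..}"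

text \<open>Measurable functions are extended-real valued, because \<open>R g\<close> below may take the value
  \<open>\<infinity>\<close>. Only the values on \<open>{0<..}\<close> ever matter.\<close>

definition meas_funs :: "(real \<Rightarrow> ereal) set" where
  "meas_funs = borel_measurable halfline"

text \<open>Powers of elements of \<open>[0,\<infinity>]\<close>; intended for exponents \<open>c > 0\<close> only, where
  \<open>\<infinity>\<^sup>c = \<infinity>\<close> and \<open>0\<^sup>c = 0\<close>.\<close>

definition ennpowr :: "ennreal \<Rightarrow> real \<Rightarrow> ennreal" where
  "ennpowr x c = (if x = \<infinity> then \<infinity> else ennreal (enn2real x powr c))"

text \<open>The set of admissible levels may be empty; \<open>Inf {} = \<infinity>\<close> in \<open>ennreal\<close>.\<close>

definition rearrangement :: "(real \<Rightarrow> ereal) \<Rightarrow> real \<Rightarrow> ennreal" where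
  "rearrangement g t =
     Inf (ennreal ` {l :: real. l > 0 \<and>
            emeasure halfline {x \<in> {0<..}. \<bar>g x\<bar> > ereal l} \<le> ennreal t})"

definition Lb_norm :: "ereal \<Rightarrow> (real \<Rightarrow> ennreal) \<Rightarrow> ennreal" where
  "Lb_norm b f =
     (if b = \<infinity> then esssup halfline f
      else ennpowr (\<integral>\<^sup>+ t. ennpowr (f t) (real_of_ereal b) \<partial>halfline) (1 / real_of_ereal b))"

text \<open>In \<open>ereal\<close> one has \<open>1 / \<infinity> = 0\<close>, so the exponent is the usual one for infinite \<open>a\<close>, \<open>b\<close>.\<close>

definition lorentz_norm :: "ereal \<Rightarrow> ereal \<Rightarrow> (real \<Rightarrow> ereal) \<Rightarrow> ennreal" where
  "lorentz_norm a b g =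
     Lb_norm b (\<lambda>t. ennreal (t powr real_of_ereal (1 / a - 1 / b)) * rearrangement g t)"

definition lorentz_admissible :: "ereal \<Rightarrow> ereal \<Rightarrow> bool" where
  "lorentz_admissible a b \<longleftrightarrow>
     (a = 1 \<and> b = 1) \<or> (1 < a \<and> a < \<infinity> \<and> 1 \<le> b) \<or> (a = \<infinity> \<and> b = \<infinity>)"

definition R_op :: "real \<Rightarrow> real \<Rightarrow> (real \<Rightarrow> ereal) \<Rightarrow> real \<Rightarrow> ereal" where
  "R_op p q g t =
     enn2ereal (ennpowr
       (ennreal (1 / t) *
         (\<integral>\<^sup>+ s \<in> {0<..<t powr (q / (q - p))}. ennpowr (rearrangement g s) p \<partial>lebesgue))
       (1 / p))"

definition lorentz_bounded ::
  "((real \<Rightarrow> ereal) \<Rightarrow> real \<Rightarrow> ereal) \<Rightarrow> ereal \<Rightarrow> ereal \<Rightarrow> ereal \<Rightarrow> ereal \<Rightarrow> bool" where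
  "lorentz_bounded T a\<^sub>1 b\<^sub>1 a\<^sub>2 b\<^sub>2 \<longleftrightarrow>
     (\<exists>C :: real. C > 0 \<and>
        (\<forall>g \<in> meas_funs. lorentz_norm a\<^sub>2 b\<^sub>2 (T g) \<le> ennreal C * lorentz_norm a\<^sub>1 b\<^sub>1 g))"

end

theory Submission
  imports Defs
begin

text \<open>
  Sufficiency. For finite \<open>s\<close>, the function \<open>R g\<close> is not monotone, but \<open>(R g)\<^sup>s\<close> has an explicit
  nonincreasing majorant: up to a constant, the integral of \<open>w powr (\<alpha> s - 1) * (g\<^sup>*(w))\<^sup>s\<close> against the
  kernel \<open>min (t powr - \<gamma>) (w powr (- \<gamma> / r))\<close>. It therefore also dominates \<open>((R g)\<^sup>*)\<^sup>s\<close>, and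
  Tonelli's theorem yields the bound from \<open>L(r\<^sub>1, s)\<close> to \<open>L(r\<^sub>2, s)\<close>; the second index is then
  adjusted by the embedding of Lorentz spaces. For \<open>s\<^sub>2 = \<infinity>\<close> a pointwise estimate of \<open>R g\<close> is enough.

  Necessity. Indicators of \<open>(0, N)\<close> force the relation between \<open>r\<^sub>1\<close> and \<open>r\<^sub>2\<close> by scaling, the
  inequality \<open>r\<^sub>2 \<ge> p\<close>, and \<open>s\<^sub>2 = \<infinity>\<close> when \<open>r\<^sub>2 = p\<close>, through the tail \<open>t powr (- 1 / p)\<close> of
  \<open>R g\<close>. The functions \<open>min 1 (t powr (- 1 / r\<^sub>1))\<close> cut off at \<open>N\<close> have norm of order
  \<open>(ln N) powr (1 / s\<^sub>1)\<close>, whereas \<open>R\<close> maps them to functions of norm at least of order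
  \<open>(ln N) powr (1 / s\<^sub>2)\<close>, or \<open>(ln N) powr (1 / p)\<close> when \<open>r\<^sub>1 = p\<close>.
\<close>

section \<open>Powers and rearrangements\<close>

lemma ennpowr_ennreal [simp]: "0 \<le> x \<Longrightarrow> ennpowr (ennreal x) c = ennreal (x powr c)"
  by (simp add: ennpowr_def)

lemma ennpowr_top [simp]: "ennpowr top c = top"
  by (simp add: ennpowr_def infinity_ennreal_def)

lemma ennpowr_0 [simp]: "ennpowr 0 c = 0"
  by (simp add: ennpowr_def)

lemma ennpowr_1 [simp]: "ennpowr x 1 = x"
  by (cases x) auto

lemma ennpowr_mono: "x \<le> y \<Longrightarrow> 0 \<le> c \<Longrightarrow> ennpowr x c \<le> ennpowr y c"
  by (cases x; cases y) (auto simp: powr_mono2 top_unique ennreal_le_iff)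

lemma ennpowr_mult: "0 < c \<Longrightarrow> ennpowr (x * y) c = ennpowr x c * ennpowr y c"
  by (cases x; cases y)
     (auto simp: powr_mult ennreal_mult_top ennreal_top_mult ennreal_mult[symmetric])

lemma ennpowr_ennpowr [simp]: "ennpowr (ennpowr x c) d = ennpowr x (c * d)"
  by (cases x) (auto simp: powr_powr)

lemma ennpowr_add: "0 < c \<Longrightarrow> 0 < d \<Longrightarrow> ennpowr x (c + d) = ennpowr x c * ennpowr x d"
  by (cases x) (auto simp: powr_add ennreal_mult ennreal_top_mult)

lemma ennpowr_measurable [measurable]:
  assumes [measurable]: "f \<in> borel_measurable M"
  shows "(\<lambda>x. ennpowr (f x) c) \<in> borel_measurable M"
  unfolding ennpowr_def infinity_ennreal_def by measurable

text \<open>Strict sublevel sets of a monotone function on the line are intervals, hence Borel.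
  Measurability of rearrangements and of the inner integral of \<open>R_op\<close> comes from
  here.\<close>

lemma borel_measurable_mono_ennreal:
  fixes f :: "real \<Rightarrow> ennreal"
  assumes "mono f \<or> antimono f"
  shows "f \<in> borel_measurable borel"
proof (rule borel_measurableI_less)
  fix y
  have "is_interval {x. f x < y}"
    unfolding is_interval_1 using assms
    by (auto simp: monotone_def intro: le_less_trans)
  then show "{x \<in> space borel. f x < y} \<in> sets borel"
    using real_interval_borel_measurable by simp
qed

text \<open>Integrals are moved from Lebesgue measure to \<open>lborel\<close>, over which Tonelli's
  theorem is applied later.\<close>

lemma nn_integral_halfline:
  "(\<integral>\<^sup>+x. f x \<partial>halfline) = (\<integral>\<^sup>+x\<in>{0<..}. f x \<partial>lborel)"
  by (simp add: nn_integral_restrict_space nn_integral_completion)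

lemma AE_halfline_iff: "(AE x in halfline. P x) \<longleftrightarrow> (AE x in lborel. 0 < x \<longrightarrow> P x)"
  by (simp add: AE_restrict_space_iff AE_completion_iff)

lemma borel_halfline: "f \<in> borel_measurable borel \<Longrightarrow> f \<in> borel_measurable halfline"
  by (intro measurable_restrict_space1 measurable_completion) simp

section \<open>Integrals of powers over intervals\<close>

lemma nn_integral_powr_0:
  assumes "0 < c" "0 \<le> b"
  shows "(\<integral>\<^sup>+x\<in>{0<..<b}. ennreal (x powr (c - 1)) \<partial>lborel) = ennreal (b powr c / c)"
proof (rule nn_integral_has_integral_lebesgue')
  show "((\<lambda>x. x powr (c - 1)) has_integral (b powr c / c)) {0<..<b}"
    using has_integral_powr_from_0[of "c - 1" b] assms by (simp add: has_integral_Icc_iff_Ioo)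
qed auto

lemma nn_integral_powr_inf:
  assumes "c < 0" "0 < b"
  shows "(\<integral>\<^sup>+x\<in>{b..}. ennreal (x powr (c - 1)) \<partial>lborel) = ennreal (b powr c / - c)"
proof (rule nn_integral_has_integral_lebesgue')
  show "((\<lambda>x. x powr (c - 1)) has_integral (b powr c / - c)) {b..}"
    using has_integral_powr_to_inf[of "c - 1" b] assms by simp
qed auto

lemma nn_integral_inverse:
  assumes "1 \<le> b"
  shows "(\<integral>\<^sup>+x\<in>{1<..<b}. ennreal (x powr - 1) \<partial>lborel) = ennreal (ln b)"
proof (rule nn_integral_has_integral_lebesgue')
  have "((\<lambda>x. x powr - 1) has_integral (ln b - ln 1)) {1..b}"
    using assms by (intro fundamental_theorem_of_calculus)
      (auto intro!: derivative_eq_intros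
        simp: has_real_derivative_iff_has_vector_derivative[symmetric] powr_minus divide_simps)
  then show "((\<lambda>x. x powr - 1) has_integral ln b) {1<..<b}"
    by (simp add: has_integral_Icc_iff_Ioo)
qed auto

section \<open>The nonincreasing rearrangement and its comparison principles\<close>

lemma rearrangement_antimono: "antimono (rearrangement g)"
  unfolding rearrangement_def
  by (intro antimonoI Inf_superset_mono image_mono) (auto intro: order_trans ennreal_leI)

lemma rearrangement_measurable [measurable]: "rearrangement g \<in> borel_measurable borel"
  using rearrangement_antimono borel_measurable_mono_ennreal by blast

text \<open>For a level \<open>l\<close> above \<open>\<Phi> t\<close>, monotonicity of the majorant
  confines the points where \<open>f\<close> exceeds \<open>l\<close> to the interval below
  \<open>t\<close>, so \<open>l\<close> is admissible. This is how the rearrangement of the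
  non-monotone function \<open>R_op p q g\<close> is bounded from above.\<close>

lemma rearrangement_upper:
  assumes "\<And>x. 0 < x \<Longrightarrow> e2ennreal \<bar>f x\<bar> \<le> \<Phi> x"
    and "\<And>x y. 0 < x \<Longrightarrow> x \<le> y \<Longrightarrow> \<Phi> y \<le> \<Phi> x" and "0 < t"
  shows "rearrangement f t \<le> \<Phi> t"
proof (rule dense_ge)
  fix z assume z: "\<Phi> t < z"
  show "rearrangement f t \<le> z"
  proof (cases z)
    case (real l)
    then have l: "0 < l" "z = ennreal l"
      using z by (auto intro: ccontr)
    have "{x \<in> {0<..}. \<bar>f x\<bar> > ereal l} \<subseteq> {0<..<t}"
    proof clarsimp
      fix x assume x: "0 < x" "ereal l < \<bar>f x\<bar>"
      show "x < t"
      proof (rule ccontr)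
        assume "\<not> x < t"
        then have "e2ennreal \<bar>f x\<bar> < ennreal l"
          using assms(1)[OF x(1)] assms(2)[of t x] \<open>0 < t\<close> z l by (meson le_less_trans not_less)
        moreover have "ennreal l \<le> e2ennreal \<bar>f x\<bar>"
          using x(2) e2ennreal_mono[of "ereal l" "\<bar>f x\<bar>"] by simp
        ultimately show False by simp
      qed
    qed
    then have "emeasure halfline {x \<in> {0<..}. \<bar>f x\<bar> > ereal l} \<le> emeasure halfline {0<..<t}"
      by (rule emeasure_mono) (auto simp: sets_restrict_space_iff)
    also have "\<dots> = ennreal t"
      using \<open>0 < t\<close> by (subst emeasure_restrict_space) auto
    finally show ?thesis
      unfolding rearrangement_def using l by (intro Inf_lower) auto
  qed simp
qed

text \<open>Every level below \<open>c\<close> is exceeded on an interval longer than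
  \<open>t\<close>, so it is not admissible. Measurability of \<open>f\<close> enters because
  \<open>emeasure\<close> is 0 on nonmeasurable sets, so monotonicity requires a measurable
  superlevel set.\<close>

lemma rearrangement_lower:
  assumes f: "f \<in> borel_measurable halfline"
    and "\<And>x. u < x \<Longrightarrow> x < v \<Longrightarrow> ennreal c \<le> e2ennreal \<bar>f x\<bar>"
    and "0 \<le> u" "0 \<le> t" "t < v - u"
  shows "ennreal c \<le> rearrangement f t"
  unfolding rearrangement_def
proof (rule Inf_greatest, clarify)
  fix l :: real
  assume l: "0 < l" "emeasure halfline {x \<in> {0<..}. \<bar>f x\<bar> > ereal l} \<le> ennreal t"
  show "ennreal c \<le> ennreal l"
  proof (rule ccontr)
    assume "\<not> ennreal c \<le> ennreal l"
    then have lc: "ennreal l < ennreal c" by simp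
    have "{u<..<v} \<subseteq> {x \<in> {0<..}. \<bar>f x\<bar> > ereal l}"
    proof clarsimp
      fix x assume x: "u < x" "x < v"
      then have "ennreal l < e2ennreal \<bar>f x\<bar>" using assms(2)[of x] lc by simp
      then have "ereal l < \<bar>f x\<bar>"
        using e2ennreal_mono[of "\<bar>f x\<bar>" "ereal l"] by (simp add: not_le[symmetric]) blast
      then show "0 < x \<and> ereal l < \<bar>f x\<bar>" using x assms(3) by simp
    qed
    moreover have "{x \<in> {0<..}. \<bar>f x\<bar> > ereal l} \<in> sets halfline"
    proof -
      have "{x \<in> space halfline. \<bar>f x\<bar> > ereal l} \<in> sets halfline" using f by measurable
      then show ?thesis by (simp add: space_restrict_space)
    qed
    ultimately have "emeasure halfline {u<..<v} \<le> ennreal t"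
      using l(2) emeasure_mono order_trans by blast
    moreover have "emeasure halfline {u<..<v} = ennreal (v - u)"
      using assms(3-5) by (subst emeasure_restrict_space) auto
    ultimately show False using assms(4,5) by (simp add: ennreal_le_iff)
  qed
qed

section \<open>Lorentz norms\<close>

text \<open>For finite \<open>s\<close> and a rearrangement \<open>G\<close> this is the
  \<open>s\<close>-th power of the Lorentz norm. The first index enters through its reciprocal
  \<open>\<alpha>\<close>, which is 0 for an infinite index.\<close>

definition lorentz_mass :: "real \<Rightarrow> real \<Rightarrow> (real \<Rightarrow> ennreal) \<Rightarrow> ennreal" where
  "lorentz_mass \<alpha> s G = (\<integral>\<^sup>+t\<in>{0<..}. (ennreal (t powr (\<alpha> * s - 1)) * ennpowr (G t) s) \<partial>lborel)"

lemma lorentz_norm_finite: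
  assumes "1 \<le> a" "0 < s"
  shows "lorentz_norm a (ereal s) g =
    ennpowr (lorentz_mass (real_of_ereal (1 / a)) s (rearrangement g)) (1 / s)"
proof -
  have e: "real_of_ereal (1 / a - 1 / ereal s) * s = real_of_ereal (1 / a) * s - 1"
    using assms by (cases a) (auto simp: field_simps one_ereal_def zero_ereal_def)
  show ?thesis
    using assms unfolding lorentz_norm_def Lb_norm_def lorentz_mass_def nn_integral_halfline
    by (simp add: ennpowr_mult powr_powr e)
qed

lemma lorentz_norm_infinity:
  "lorentz_norm a \<infinity> g =
    esssup halfline (\<lambda>t. ennreal (t powr real_of_ereal (1 / a)) * rearrangement g t)"
  by (simp add: lorentz_norm_def Lb_norm_def)

lemma lorentz_norm_infinity_AE:
  "AE t in lborel. 0 < t \<longrightarrow>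
     ennreal (t powr real_of_ereal (1 / a)) * rearrangement g t \<le> lorentz_norm a \<infinity> g"
  unfolding lorentz_norm_infinity AE_halfline_iff[symmetric] by (rule esssup_AE)

lemma lorentz_norm_infinity_le:
  assumes "\<And>t. 0 < t \<Longrightarrow> ennreal (t powr real_of_ereal (1 / a)) * rearrangement g t \<le> A"
  shows "lorentz_norm a \<infinity> g \<le> A"
  unfolding lorentz_norm_infinity
proof (rule esssup_I)
  show "(\<lambda>t. ennreal (t powr real_of_ereal (1 / a)) * rearrangement g t) \<in> borel_measurable halfline"
    by (rule borel_halfline) measurable
  show "AE t in halfline. ennreal (t powr real_of_ereal (1 / a)) * rearrangement g t \<le> A"
    using assms by (simp add: AE_halfline_iff)
qed

text \<open>The power \<open>v powr c\<close> is \<open>c\<close> times the integral of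
  \<open>w powr (c - 1)\<close> over \<open>(0, v)\<close>, and there \<open>H w\<close> is at least
  \<open>H v\<close>.\<close>

lemma antimono_le_powr_average:
  fixes H :: "real \<Rightarrow> ennreal"
  assumes "antimono H" "0 < c" "0 < v"
  shows "ennreal (v powr c) * H v \<le>
    ennreal c * (\<integral>\<^sup>+w\<in>{0<..<v}. (ennreal (w powr (c - 1)) * H w) \<partial>lborel)"
proof -
  have "ennreal (v powr c) * H v =
      ennreal c * ((\<integral>\<^sup>+w\<in>{0<..<v}. ennreal (w powr (c - 1)) \<partial>lborel) * H v)"
    using assms by (simp add: nn_integral_powr_0 mult.assoc[symmetric] ennreal_mult[symmetric])
  also have "(\<integral>\<^sup>+w\<in>{0<..<v}. ennreal (w powr (c - 1)) \<partial>lborel) * H v =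
      (\<integral>\<^sup>+w. ennreal (w powr (c - 1)) * indicator {0<..<v} w * H v \<partial>lborel)"
    by (subst nn_integral_multc) auto
  also have "\<dots> \<le> (\<integral>\<^sup>+w\<in>{0<..<v}. (ennreal (w powr (c - 1)) * H w) \<partial>lborel)"
    using antimonoD[OF assms(1)]
    by (intro nn_integral_mono) (auto simp: indicator_def intro!: mult_left_mono)
  finally show ?thesis by (simp add: mult_left_mono)
qed

lemma ennpowr_antimono: "antimono G \<Longrightarrow> 0 \<le> c \<Longrightarrow> antimono (\<lambda>t. ennpowr (G t) c)"
  by (auto simp: antimono_def intro: ennpowr_mono)

text \<open>Apply the averaging bound to the \<open>s\<close>-th power of \<open>G\<close>, enlarge
  the domain to the half-line and take roots. This is the embedding into the weak space.\<close>

lemma weak_le_lorentz_mass: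
  assumes "antimono G" "0 < \<alpha>" "0 < s" "0 < t"
  shows "ennreal (t powr \<alpha>) * G t \<le>
    ennreal ((\<alpha> * s) powr (1 / s)) * ennpowr (lorentz_mass \<alpha> s G) (1 / s)"
proof -
  have "ennreal (t powr (\<alpha> * s)) * ennpowr (G t) s \<le> ennreal (\<alpha> * s) *
      (\<integral>\<^sup>+w\<in>{0<..<t}. (ennreal (w powr (\<alpha> * s - 1)) * ennpowr (G w) s) \<partial>lborel)"
    using assms by (intro antimono_le_powr_average ennpowr_antimono) auto
  also have "\<dots> \<le> ennreal (\<alpha> * s) * lorentz_mass \<alpha> s G"
    unfolding lorentz_mass_def
    by (intro mult_left_mono nn_integral_mono) (auto simp: indicator_def)
  finally have "ennpowr (ennreal (t powr (\<alpha> * s)) * ennpowr (G t) s) (1 / s)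
      \<le> ennpowr (ennreal (\<alpha> * s) * lorentz_mass \<alpha> s G) (1 / s)"
    using assms by (intro ennpowr_mono) auto
  then show ?thesis
    using assms by (simp add: ennpowr_mult powr_powr)
qed

text \<open>From the power \<open>s'\<close> of \<open>G\<close> the excess \<open>s' - s\<close> is
  split off together with the matching power of \<open>t\<close> and bounded by the weak norm; what
  remains is the integrand for \<open>s\<close>.\<close>

lemma lorentz_mass_embedding:
  assumes "antimono G" "0 < \<alpha>" "0 < s" "s < s'"
  shows "ennpowr (lorentz_mass \<alpha> s' G) (1 / s') \<le>
    ennreal ((\<alpha> * s) powr ((s' - s) / (s * s'))) * ennpowr (lorentz_mass \<alpha> s G) (1 / s)"
proof -
  have [measurable]: "G \<in> borel_measurable borel"
    using assms borel_measurable_mono_ennreal by blast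
  \<comment> \<open>The bound of \<open>weak_le_lorentz_mass\<close> for
    \<open>t powr \<alpha> * G t\<close>, uniform in \<open>t\<close>.\<close>
  define A where "A = ennreal ((\<alpha> * s) powr (1 / s)) * ennpowr (lorentz_mass \<alpha> s G) (1 / s)"
  have "lorentz_mass \<alpha> s' G \<le> (\<integral>\<^sup>+t. ennpowr A (s' - s) *
      (ennreal (t powr (\<alpha> * s - 1)) * ennpowr (G t) s * indicator {0<..} t) \<partial>lborel)"
    unfolding lorentz_mass_def
  proof (intro nn_integral_mono)
    fix t :: real
    show "ennreal (t powr (\<alpha> * s' - 1)) * ennpowr (G t) s' * indicator {0<..} t \<le>
      ennpowr A (s' - s) * (ennreal (t powr (\<alpha> * s - 1)) * ennpowr (G t) s * indicator {0<..} t)"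
    proof (cases "0 < t")
      case True
      have "ennreal (t powr (\<alpha> * s' - 1)) * ennpowr (G t) s' =
          ennpowr (ennreal (t powr \<alpha>) * G t) (s' - s) * (ennreal (t powr (\<alpha> * s - 1)) * ennpowr (G t) s)"
      proof -
        have "t powr (\<alpha> * s' - 1) = t powr (\<alpha> * (s' - s)) * t powr (\<alpha> * s - 1)"
          by (simp add: powr_add[symmetric] algebra_simps)
        moreover have "ennpowr (G t) s' = ennpowr (G t) (s' - s) * ennpowr (G t) s"
          using assms by (subst ennpowr_add[symmetric]) auto
        ultimately show ?thesis
          using assms by (simp add: ennpowr_mult powr_powr ennreal_mult ac_simps)
      qed
      also have "\<dots> \<le> ennpowr A (s' - s) * (ennreal (t powr (\<alpha> * s - 1)) * ennpowr (G t) s)"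
        using weak_le_lorentz_mass[OF assms(1-3) True] assms unfolding A_def
        by (intro mult_right_mono ennpowr_mono) auto
      finally show ?thesis using True by simp
    qed simp
  qed
  also have "\<dots> = ennpowr A (s' - s) * lorentz_mass \<alpha> s G"
    unfolding lorentz_mass_def by (subst nn_integral_cmult) auto
  also have "\<dots> = ennreal ((\<alpha> * s) powr ((s' - s) / s)) * ennpowr (lorentz_mass \<alpha> s G) (s' / s)"
  proof -
    have "ennpowr (lorentz_mass \<alpha> s G) (s' / s) =
        ennpowr (lorentz_mass \<alpha> s G) ((s' - s) / s) * ennpowr (lorentz_mass \<alpha> s G) 1"
      using assms by (subst ennpowr_add[symmetric]) (auto simp: field_simps)
    then show ?thesis
      using assms unfolding A_def by (simp add: ennpowr_mult powr_powr ac_simps)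
  qed
  finally have "ennpowr (lorentz_mass \<alpha> s' G) (1 / s') \<le> ennpowr (ennreal ((\<alpha> * s) powr ((s' - s) / s)) * ennpowr (lorentz_mass \<alpha> s G) (s' / s)) (1 / s')"
    using assms by (intro ennpowr_mono) auto
  then show ?thesis
    using assms by (simp add: ennpowr_mult powr_powr)
qed

lemma real_of_ereal_inverse [simp]: "real_of_ereal (1 / ereal x) = 1 / x"
  by (simp add: one_ereal_def)

lemma real_of_ereal_inverse_nonneg: "1 \<le> a \<Longrightarrow> 0 \<le> real_of_ereal (1 / a)"
  by (cases a) (auto simp: one_ereal_def)

lemma real_of_ereal_inverse_pos: "1 \<le> a \<Longrightarrow> a < \<infinity> \<Longrightarrow> 0 < real_of_ereal (1 / a)"
  by (cases a) (auto simp: one_ereal_def)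

lemma lorentz_embedding:
  assumes "1 \<le> a" "1 \<le> s" "s \<le> s'" "a < \<infinity> \<or> s = s'"
  shows "\<exists>K>0. \<forall>g. lorentz_norm a s' g \<le> ennreal K * lorentz_norm a s g"
proof (cases "s = s'")
  case True
  then show ?thesis by (intro exI[of _ 1]) auto
next
  case False
  define \<alpha> where "\<alpha> = real_of_ereal (1 / a)"
  have \<alpha>: "0 < \<alpha>"
    using False assms unfolding \<alpha>_def by (intro real_of_ereal_inverse_pos) auto
  obtain b where b: "s = ereal b" "1 \<le> b"
    using assms False by (cases s) (auto simp: one_ereal_def)
  show ?thesis
  proof (cases "s' = \<infinity>")
    case True
    have "lorentz_norm a s' g \<le> ennreal ((\<alpha> * b) powr (1 / b)) * lorentz_norm a s g" for g
      unfolding True b using b assms \<alpha>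
      by (intro lorentz_norm_infinity_le)
        (auto simp: lorentz_norm_finite \<alpha>_def intro!: weak_le_lorentz_mass rearrangement_antimono)
    then show ?thesis using \<alpha> b by (intro exI[of _ "(\<alpha> * b) powr (1 / b)"]) auto
  next
    case fin: False
    then obtain b' where b': "s' = ereal b'" "b < b'"
      using b assms False by (cases s') auto
    have "lorentz_norm a s' g \<le> ennreal ((\<alpha> * b) powr ((b' - b) / (b * b'))) * lorentz_norm a s g" for g
      unfolding b b' using b b' assms \<alpha>
      by (auto simp: lorentz_norm_finite \<alpha>_def intro!: lorentz_mass_embedding rearrangement_antimono)
    then show ?thesis
      using \<alpha> b by (intro exI[of _ "(\<alpha> * b) powr ((b' - b) / (b * b'))"]) auto
  qed
qed

text \<open>A null set contains no open interval. This turns the almost everywhere bound given by an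
  essential supremum into a bound at a concrete point.\<close>

lemma AE_lborel_interval:
  assumes "AE t in lborel. P t" "a < (b::real)"
  obtains t where "a < t" "t < b" "P t"
proof -
  have "\<not> (AE t in lborel. t \<notin> {a<..<b})"
    using assms(2) by (subst AE_iff_measurable[of "{a<..<b}"]) auto
  then have "\<exists>t. P t \<and> t \<in> {a<..<b}"
    using eventually_mono[OF assms(1), of "\<lambda>t. t \<notin> {a<..<b}"] by blast
  then show ?thesis using that by auto
qed

text \<open>The rearrangement is at least \<open>c\<close> on \<open>(0, v - u)\<close>, so the norm
  is bounded below by \<open>c\<close> times the norm of an indicator. The constant is obtained
  first because it must serve all functions and intervals at once.\<close>

lemma lorentz_norm_lower:
  assumes "1 \<le> a" "1 \<le> s" "a < \<infinity> \<or> s = \<infinity>"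
  obtains \<kappa> where "0 < \<kappa>"
    "\<And>f u v c. f \<in> borel_measurable halfline \<Longrightarrow> 0 \<le> u \<Longrightarrow> u < v \<Longrightarrow> 0 \<le> c \<Longrightarrow>
      (\<And>x. u < x \<Longrightarrow> x < v \<Longrightarrow> ennreal c \<le> e2ennreal \<bar>f x\<bar>) \<Longrightarrow>
      ennreal (\<kappa> * (v - u) powr real_of_ereal (1 / a) * c) \<le> lorentz_norm a s f"
proof -
  define \<alpha> where "\<alpha> = real_of_ereal (1 / a)"
  have \<alpha>0: "0 \<le> \<alpha>"
    unfolding \<alpha>_def by (intro real_of_ereal_inverse_nonneg assms)
  show ?thesis
  proof (cases "s = \<infinity>")
    case True
    show ?thesis
    \<comment> \<open>The weak norm is only seen at almost every point, so it is evaluated at some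
      \<open>t\<close> in the upper half of \<open>(0, v - u)\<close>; this costs the factor
      \<open>2 powr - \<alpha>\<close>.\<close>
    proof (rule that[of "2 powr - \<alpha>"])
      fix f :: "real \<Rightarrow> ereal" and u v c :: real
      assume A: "f \<in> borel_measurable halfline" "0 \<le> u" "u < v" "0 \<le> c"
        "\<And>x. u < x \<Longrightarrow> x < v \<Longrightarrow> ennreal c \<le> e2ennreal \<bar>f x\<bar>"
      obtain t where t: "(v - u) / 2 < t" "t < v - u"
        "0 < t \<longrightarrow> ennreal (t powr \<alpha>) * rearrangement f t \<le> lorentz_norm a \<infinity> f"
        using AE_lborel_interval[OF lorentz_norm_infinity_AE[of a f], of "(v - u) / 2" "v - u"] A
        unfolding \<alpha>_def by auto
      have t0: "0 < t" using t(1) \<open>u < v\<close> by simp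
      have "ennreal (2 powr - \<alpha> * (v - u) powr \<alpha> * c) \<le> ennreal (t powr \<alpha> * c)"
      proof (intro ennreal_leI mult_right_mono)
        have "2 powr - \<alpha> * (v - u) powr \<alpha> = ((v - u) / 2) powr \<alpha>"
          using A by (simp add: powr_divide powr_minus field_simps)
        also have "\<dots> \<le> t powr \<alpha>" using t A \<alpha>0 by (intro powr_mono2) auto
        finally show "2 powr - \<alpha> * (v - u) powr \<alpha> \<le> t powr \<alpha>" .
      qed (use A in auto)
      also have "\<dots> = ennreal (t powr \<alpha>) * ennreal c" using A by (simp add: ennreal_mult)
      also have "\<dots> \<le> ennreal (t powr \<alpha>) * rearrangement f t"
        using A t t0 by (intro mult_left_mono rearrangement_lower[of f u v]) auto
      also have "\<dots> \<le> lorentz_norm a s f" using t t0 True by simp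
      finally show "ennreal (2 powr - \<alpha> * (v - u) powr real_of_ereal (1 / a) * c) \<le> lorentz_norm a s f"
        by (simp add: \<alpha>_def)
    qed simp
  next
    case False
    then obtain b where b: "s = ereal b" "1 \<le> b"
      using assms by (cases s) (auto simp: one_ereal_def)
    have \<alpha>: "0 < \<alpha>"
      using False assms unfolding \<alpha>_def by (intro real_of_ereal_inverse_pos) auto
    show ?thesis
    \<comment> \<open>The norm of the indicator of \<open>(0, 1)\<close>: the weight
      \<open>t powr (\<alpha> * b - 1)\<close> has integral \<open>1 / (\<alpha> * b)\<close>
      there.\<close>
    proof (rule that[of "(1 / (\<alpha> * b)) powr (1 / b)"])
      fix f :: "real \<Rightarrow> ereal" and u v c :: real
      assume A: "f \<in> borel_measurable halfline" "0 \<le> u" "u < v" "0 \<le> c"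
        "\<And>x. u < x \<Longrightarrow> x < v \<Longrightarrow> ennreal c \<le> e2ennreal \<bar>f x\<bar>"
      have "ennreal ((v - u) powr (\<alpha> * b) / (\<alpha> * b)) * ennreal (c powr b) =
          (\<integral>\<^sup>+t\<in>{0<..<v - u}. ennreal (t powr (\<alpha> * b - 1)) \<partial>lborel) * ennreal (c powr b)"
        using A \<alpha> b by (subst nn_integral_powr_0) auto
      also have "\<dots> = (\<integral>\<^sup>+t. ennreal (t powr (\<alpha> * b - 1)) * indicator {0<..<v - u} t * ennreal (c powr b) \<partial>lborel)"
        by (subst nn_integral_multc) auto
      also have "\<dots> \<le> lorentz_mass \<alpha> b (rearrangement f)"
        unfolding lorentz_mass_def
      proof (intro nn_integral_mono)
        fix t :: real
        have "ennreal (c powr b) \<le> ennpowr (rearrangement f t) b" if "0 < t" "t < v - u"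
          using ennpowr_mono[OF rearrangement_lower[of f u v c t], of b] A b that by simp
        then show "ennreal (t powr (\<alpha> * b - 1)) * indicator {0<..<v - u} t * ennreal (c powr b)
          \<le> ennreal (t powr (\<alpha> * b - 1)) * ennpowr (rearrangement f t) b * indicator {0<..} t"
          by (auto simp: indicator_def intro!: mult_left_mono)
      qed
      finally have "ennpowr (ennreal ((v - u) powr (\<alpha> * b) / (\<alpha> * b)) * ennreal (c powr b)) (1 / b)
          \<le> ennpowr (lorentz_mass \<alpha> b (rearrangement f)) (1 / b)"
        using b by (intro ennpowr_mono) auto
      also have "\<dots> = lorentz_norm a s f"
        using b assms by (simp add: lorentz_norm_finite \<alpha>_def)
      also have "ennpowr (ennreal ((v - u) powr (\<alpha> * b) / (\<alpha> * b)) * ennreal (c powr b)) (1 / b) =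
          ennreal ((1 / (\<alpha> * b)) powr (1 / b) * (v - u) powr \<alpha> * c)"
        using A b \<alpha> by (simp add: ennreal_mult[symmetric] powr_mult powr_divide powr_powr)
      finally show "ennreal ((1 / (\<alpha> * b)) powr (1 / b) * (v - u) powr real_of_ereal (1 / a) * c) \<le> lorentz_norm a s f"
        by (simp add: \<alpha>_def)
    qed (use b \<alpha> in auto)
  qed
qed

section \<open>The Hardy-type estimate\<close>

text \<open>The operator of \<open>R_op\<close> acting on an arbitrary \<open>G\<close> in place of
  a rearrangement, with \<open>r\<close> as a free parameter and values kept in
  \<open>ennreal\<close>.\<close>

definition hardy :: "real \<Rightarrow> real \<Rightarrow> (real \<Rightarrow> ennreal) \<Rightarrow> real \<Rightarrow> ennreal" where
  "hardy p r G t = ennpowr (ennreal (1 / t) * (\<integral>\<^sup>+w\<in>{0<..<t powr r}. ennpowr (G w) p \<partial>lborel)) (1 / p)"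

lemma R_op_eq_hardy: "R_op p q g t = enn2ereal (hardy p (q / (q - p)) (rearrangement g) t)"
  by (simp add: R_op_def hardy_def nn_integral_completion)

lemma R_op_abs [simp]: "e2ennreal \<bar>R_op p q g t\<bar> = hardy p (q / (q - p)) (rearrangement g) t"
  by (simp add: R_op_eq_hardy)

lemma R_op_measurable: "0 \<le> q / (q - p) \<Longrightarrow> R_op p q g \<in> borel_measurable halfline"
proof -
  assume r: "0 \<le> q / (q - p)"
  \<comment> \<open>Cutting off at 0 makes \<open>I\<close> monotone on the whole line without
    affecting positive arguments.\<close>
  define I where "I t = (\<integral>\<^sup>+w\<in>{0<..<(max 0 t) powr (q / (q - p))}. ennpowr (rearrangement g w) p \<partial>lborel)" for t :: real
  have "mono I"
  proof (rule monoI)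
    fix x y :: real assume "x \<le> y"
    then have "(max 0 x) powr (q / (q - p)) \<le> (max 0 y) powr (q / (q - p))"
      using r by (intro powr_mono2) auto
    then show "I x \<le> I y"
      unfolding I_def by (intro nn_integral_mono) (auto simp: indicator_def)
  qed
  then have [measurable]: "I \<in> borel_measurable borel"
    using borel_measurable_mono_ennreal by blast
  have "(\<lambda>t. enn2ereal (ennpowr (ennreal (1 / t) * I t) (1 / p))) \<in> borel_measurable halfline"
    by (rule borel_halfline) measurable
  then show ?thesis
    by (subst measurable_cong[of _ _ "\<lambda>t. enn2ereal (ennpowr (ennreal (1 / t) * I t) (1 / p))"])
      (auto simp: R_op_eq_hardy hardy_def I_def space_restrict_space)
qed

text \<open>The integrand is bounded by \<open>w powr (e - 1)\<close> times the supremum of \<open>v powr (1 - e) * (G v)\<^sup>p\<close> over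
  \<open>v < T\<close>. This avoids Hoelder's inequality, so that \<open>s < p\<close> and \<open>s \<ge> p\<close> need not be distinguished.\<close>

lemma nn_integral_ennpowr_le:
  fixes G :: "real \<Rightarrow> ennreal"
  assumes "antimono G" "0 < p" "0 < s" "0 < e" "e < 1" "0 < T"
  defines "\<alpha> \<equiv> (1 - e) / p"
  shows "(\<integral>\<^sup>+w\<in>{0<..<T}. ennpowr (G w) p \<partial>lborel) \<le> ennreal (T powr e / e) *
    ennpowr (ennreal (\<alpha> * s) * (\<integral>\<^sup>+w\<in>{0<..<T}. (ennreal (w powr (\<alpha> * s - 1)) * ennpowr (G w) s) \<partial>lborel)) (p / s)"
    (is "?L \<le> _ * ennpowr ?S _")
proof -
  have \<alpha>: "0 < \<alpha>" using assms by (simp add: \<alpha>_def)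
  have "?L \<le> (\<integral>\<^sup>+w. ennreal (w powr (e - 1)) * indicator {0<..<T} w * ennpowr ?S (p / s) \<partial>lborel)"
  proof (intro nn_integral_mono)
    fix v :: real
    show "ennpowr (G v) p * indicator {0<..<T} v \<le>
      ennreal (v powr (e - 1)) * indicator {0<..<T} v * ennpowr ?S (p / s)"
    proof (cases "v \<in> {0<..<T}")
      case True
      have "ennreal (v powr (\<alpha> * s)) * ennpowr (G v) s \<le> ennreal (\<alpha> * s) *
          (\<integral>\<^sup>+w\<in>{0<..<v}. (ennreal (w powr (\<alpha> * s - 1)) * ennpowr (G w) s) \<partial>lborel)"
        using assms \<alpha> True by (intro antimono_le_powr_average ennpowr_antimono) auto
      also have "\<dots> \<le> ?S"
        using True by (intro mult_left_mono nn_integral_mono) (auto simp: indicator_def)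
      finally have "ennpowr (ennreal (v powr (\<alpha> * s)) * ennpowr (G v) s) (p / s) \<le> ennpowr ?S (p / s)"
        using assms by (intro ennpowr_mono) auto
      then have "ennreal (v powr (\<alpha> * p)) * ennpowr (G v) p \<le> ennpowr ?S (p / s)"
        using assms(2,3) by (simp add: ennpowr_mult powr_powr)
      then have "ennreal (v powr (e - 1)) * (ennreal (v powr (\<alpha> * p)) * ennpowr (G v) p) \<le>
          ennreal (v powr (e - 1)) * ennpowr ?S (p / s)"
        by (rule mult_left_mono) simp
      moreover have "ennreal (v powr (e - 1)) * ennreal (v powr (\<alpha> * p)) = 1"
        using True assms(2) by (simp add: \<alpha>_def ennreal_mult[symmetric] powr_add[symmetric])
      ultimately show ?thesis using True by (simp add: mult.assoc[symmetric])
    qed simp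
  qed
  also have "\<dots> = (\<integral>\<^sup>+w\<in>{0<..<T}. ennreal (w powr (e - 1)) \<partial>lborel) * ennpowr ?S (p / s)"
    by (subst nn_integral_multc) auto
  also have "\<dots> = ennreal (T powr e / e) * ennpowr ?S (p / s)"
    using assms by (subst nn_integral_powr_0) auto
  finally show ?thesis .
qed

text \<open>With \<open>T = t powr r\<close> the preceding estimate carries the factor
  \<open>t powr (r * e - 1)\<close>, whose power \<open>s / p\<close> is
  \<open>t powr - \<gamma>\<close>. For fixed \<open>w\<close> the resulting kernel vanishes until
  \<open>t\<close> passes \<open>w powr (1 / r)\<close> and is \<open>t powr - \<gamma>\<close>
  afterwards; the minimum is its least nonincreasing majorant, which makes
  \<open>rearrangement_upper\<close> applicable.\<close>

lemma hardy_powr_le: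
  assumes G: "antimono G" and "0 < p" "0 < r" "0 < s" "0 < e" "e < 1" "0 < t"
  defines "\<alpha> \<equiv> (1 - e) / p" and "\<gamma> \<equiv> (1 - r * e) * s / p"
  assumes "0 < \<gamma>"
  shows "ennpowr (hardy p r G t) s \<le> ennreal (e powr (- s / p) * (\<alpha> * s)) *
    (\<integral>\<^sup>+w\<in>{0<..}. (ennreal (min (t powr - \<gamma>) (w powr (- \<gamma> / r))) *
       (ennreal (w powr (\<alpha> * s - 1)) * ennpowr (G w) s)) \<partial>lborel)"
proof -
  have [measurable]: "G \<in> borel_measurable borel"
    using G borel_measurable_mono_ennreal by blast
  have \<alpha>: "0 < \<alpha>" using assms by (simp add: \<alpha>_def)
  let ?I = "\<integral>\<^sup>+w\<in>{0<..<t powr r}. (ennreal (w powr (\<alpha> * s - 1)) * ennpowr (G w) s) \<partial>lborel"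
  have "ennreal (1 / t) * (\<integral>\<^sup>+w\<in>{0<..<t powr r}. ennpowr (G w) p \<partial>lborel) \<le>
     ennreal (1 / t) * (ennreal ((t powr r) powr e / e) * ennpowr (ennreal (\<alpha> * s) * ?I) (p / s))"
    unfolding \<alpha>_def using assms by (intro mult_left_mono nn_integral_ennpowr_le) auto
  also have "\<dots> = ennreal (t powr (r * e - 1) / e) * ennpowr (ennreal (\<alpha> * s) * ?I) (p / s)"
    using assms by (simp add: ennreal_mult[symmetric] mult.assoc[symmetric] powr_powr powr_diff)
  finally have "ennpowr (hardy p r G t) s \<le>
      ennpowr (ennreal (t powr (r * e - 1) / e) * ennpowr (ennreal (\<alpha> * s) * ?I) (p / s)) (s / p)"
    unfolding hardy_def using assms by (simp add: ennpowr_mono)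
  also have "\<dots> = ennreal ((t powr (r * e - 1) / e) powr (s / p)) * (ennreal (\<alpha> * s) * ?I)"
    using assms(2-6) by (simp add: ennpowr_mult)
  also have "(t powr (r * e - 1) / e) powr (s / p) = t powr - \<gamma> * e powr (- s / p)"
  proof -
    have "(r * e - 1) * (s / p) = - \<gamma>"
      by (simp add: \<gamma>_def algebra_simps diff_divide_distrib)
    moreover have "e powr (- s / p) = 1 / e powr (s / p)"
      using assms(5) by (simp add: powr_minus divide_simps)
    ultimately show ?thesis using assms(5) by (simp add: powr_divide powr_powr)
  qed
  also have "ennreal (t powr - \<gamma> * e powr (- s / p)) * (ennreal (\<alpha> * s) * ?I) =
      ennreal (e powr (- s / p) * (\<alpha> * s)) * (ennreal (t powr - \<gamma>) * ?I)"
    using \<alpha> assms(2-6) by (simp add: ennreal_mult ac_simps)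
  also have "ennreal (t powr - \<gamma>) * ?I = (\<integral>\<^sup>+w. ennreal (t powr - \<gamma>) *
      (ennreal (w powr (\<alpha> * s - 1)) * ennpowr (G w) s * indicator {0<..<t powr r} w) \<partial>lborel)"
    by (subst nn_integral_cmult) auto
  also have "\<dots> \<le> (\<integral>\<^sup>+w\<in>{0<..}. (ennreal (min (t powr - \<gamma>) (w powr (- \<gamma> / r))) *
       (ennreal (w powr (\<alpha> * s - 1)) * ennpowr (G w) s)) \<partial>lborel)"
  proof (intro nn_integral_mono)
    fix w :: real
    \<comment> \<open>On the original domain of integration the minimum is
      \<open>t powr - \<gamma>\<close>, so nothing is lost there.\<close>
    have "t powr - \<gamma> \<le> w powr (- \<gamma> / r)" if "0 < w" "w < t powr r"
    proof -
      have "(t powr r) powr (- \<gamma> / r) \<le> w powr (- \<gamma> / r)"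
        using that \<open>0 < \<gamma>\<close> \<open>0 < r\<close> by (intro powr_mono2') auto
      then show ?thesis using \<open>0 < r\<close> by (simp add: powr_powr)
    qed
    then show "ennreal (t powr - \<gamma>) * (ennreal (w powr (\<alpha> * s - 1)) * ennpowr (G w) s * indicator {0<..<t powr r} w)
      \<le> ennreal (min (t powr - \<gamma>) (w powr (- \<gamma> / r))) *
       (ennreal (w powr (\<alpha> * s - 1)) * ennpowr (G w) s) * indicator {0<..} w"
      by (auto simp: indicator_def min_def)
  qed
  finally show ?thesis by (simp add: mult_left_mono)
qed

text \<open>The two branches of the minimum cross at \<open>t = w powr (1 / r)\<close>. Below this
  point the integral converges because \<open>a > 0\<close>, above it because \<open>a < c\<close>,
  and both pieces are multiples of the power \<open>a - c\<close> of the crossing point.\<close>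

lemma nn_integral_powr_min:
  assumes "0 < a" "a < c" "0 < r" "0 < (w::real)"
  shows "(\<integral>\<^sup>+t\<in>{0<..}. (ennreal (t powr (a - 1)) * ennreal (min (t powr - c) (w powr (- c / r)))) \<partial>lborel)
    \<le> ennreal ((1 / a + 1 / (c - a)) * w powr ((a - c) / r))"
proof -
  define b where "b = w powr (1 / r)"
  have b: "0 < b" using assms by (simp add: b_def)
  have "(\<integral>\<^sup>+t\<in>{0<..}. (ennreal (t powr (a - 1)) * ennreal (min (t powr - c) (w powr (- c / r)))) \<partial>lborel)
    \<le> (\<integral>\<^sup>+t. ennreal (t powr (a - 1)) * indicator {0<..<b} t * ennreal (b powr - c) +
         ennreal (t powr ((a - c) - 1)) * indicator {b..} t \<partial>lborel)"
  proof (intro nn_integral_mono)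
    fix t :: real
    show "ennreal (t powr (a - 1)) * ennreal (min (t powr - c) (w powr (- c / r))) * indicator {0<..} t
      \<le> ennreal (t powr (a - 1)) * indicator {0<..<b} t * ennreal (b powr - c) +
         ennreal (t powr ((a - c) - 1)) * indicator {b..} t"
    proof (cases "t < b")
      case True
      then show ?thesis
        by (auto simp: indicator_def b_def powr_powr intro!: mult_left_mono)
    next
      case False
      have "ennreal (t powr (a - 1)) * ennreal (min (t powr - c) (w powr (- c / r))) \<le>
          ennreal (t powr (a - 1)) * ennreal (t powr - c)"
        by (intro mult_left_mono ennreal_leI) auto
      also have "\<dots> = ennreal (t powr ((a - c) - 1))"
        by (simp add: ennreal_mult[symmetric] powr_add[symmetric] algebra_simps)
      finally show ?thesis using False b by (auto simp: indicator_def)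
    qed
  qed
  also have "\<dots> = (\<integral>\<^sup>+t\<in>{0<..<b}. ennreal (t powr (a - 1)) \<partial>lborel) * ennreal (b powr - c) +
      (\<integral>\<^sup>+t\<in>{b..}. ennreal (t powr ((a - c) - 1)) \<partial>lborel)"
    by (subst nn_integral_add) (auto simp: nn_integral_multc)
  also have "\<dots> = ennreal (b powr a / a * b powr - c + b powr (a - c) / (c - a))"
    using assms b by (subst nn_integral_powr_0, simp, simp, subst nn_integral_powr_inf)
      (auto simp: ennreal_mult[symmetric] ennreal_plus[symmetric] simp del: ennreal_plus)
  also have "b powr a / a * b powr - c + b powr (a - c) / (c - a) = (1 / a + 1 / (c - a)) * b powr (a - c)"
  proof -
    have "b powr (a - c) = b powr a * b powr - c" by (simp add: powr_add[symmetric])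
    then show ?thesis by (simp add: distrib_right)
  qed
  also have "b powr (a - c) = w powr ((a - c) / r)"
    by (simp add: b_def powr_powr)
  finally show ?thesis .
qed

text \<open>The majorant from \<open>hardy_powr_le\<close> is nonincreasing, so it dominates the
  rearrangement of \<open>R_op p q g\<close> as well. After Tonelli's theorem only the kernel is
  integrated in \<open>t\<close>, and \<open>nn_integral_powr_min\<close> bounds the result.\<close>

lemma lorentz_mass_R_op_le:
  assumes "0 < p" "p < q" "0 < s" "0 < \<alpha>\<^sub>2" "\<alpha>\<^sub>2 < 1 / p"
  defines "r \<equiv> q / (q - p)"
  obtains K where "0 < K" "\<And>g. lorentz_mass \<alpha>\<^sub>2 s (rearrangement (R_op p q g)) \<le>
    ennreal K * lorentz_mass (1 / q + \<alpha>\<^sub>2 / r) s (rearrangement g)"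
proof -
  have r: "1 < r" using assms by (simp add: r_def field_simps)
  have q: "1 / q = (1 - 1 / r) / p" using assms by (simp add: r_def field_simps)
  \<comment> \<open>Any \<open>e > 0\<close> with \<open>r * e < 1 - p * \<alpha>\<^sub>2\<close>
    would serve, since the second inequality amounts to \<open>a < \<gamma>\<close>. Half of the
    upper bound is taken.\<close>
  define e where "e = (1 - p * \<alpha>\<^sub>2) / (2 * r)"
  define \<alpha> where "\<alpha> = (1 - e) / p"
  define \<gamma> where "\<gamma> = (1 - r * e) * s / p"
  define a where "a = \<alpha>\<^sub>2 * s"
  have p\<alpha>: "0 < p * \<alpha>\<^sub>2" "p * \<alpha>\<^sub>2 < 1" using assms by (auto simp: field_simps)
  have e: "0 < e" "e < 1" using p\<alpha> r by (auto simp: e_def field_simps)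
  have re: "r * e = (1 - p * \<alpha>\<^sub>2) / 2" using r by (simp add: e_def)
  have a: "0 < a" using assms by (simp add: a_def)
  have a\<gamma>: "a < \<gamma>"
  proof -
    have "\<alpha>\<^sub>2 < (1 - r * e) / p" unfolding re using assms p\<alpha> by (simp add: field_simps)
    then have "\<alpha>\<^sub>2 * s < (1 - r * e) / p * s" using assms(3) by (rule mult_strict_right_mono)
    then show ?thesis by (simp add: a_def \<gamma>_def)
  qed
  have \<alpha>: "0 < \<alpha>" using e assms by (simp add: \<alpha>_def)
  define C1 where "C1 = e powr (- s / p) * (\<alpha> * s)"
  define C2 where "C2 = 1 / a + 1 / (\<gamma> - a)"
  have C: "0 < C1" "0 < C2" using e \<alpha> assms a a\<gamma> by (auto simp: C1_def C2_def add_pos_pos)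
  \<comment> \<open>The parameter \<open>e\<close> cancels: it contributes \<open>e * s / p\<close>
    through \<open>- \<gamma> / r\<close> and \<open>- e * s / p\<close> through
    \<open>\<alpha> * s\<close>.\<close>
  have expo: "(a - \<gamma>) / r + (\<alpha> * s - 1) = (1 / q + \<alpha>\<^sub>2 / r) * s - 1"
    unfolding q a_def \<gamma>_def \<alpha>_def using r assms(1) by (simp add: field_simps)
  have bound: "lorentz_mass \<alpha>\<^sub>2 s (rearrangement (R_op p q g)) \<le>
    ennreal (C1 * C2) * lorentz_mass (1 / q + \<alpha>\<^sub>2 / r) s (rearrangement g)" for g
  proof -
    let ?G = "rearrangement g"
    define k where "k t w = ennreal (min (t powr - \<gamma>) (w powr (- \<gamma> / r)))" for t w :: real
    define h where "h w = ennreal (w powr (\<alpha> * s - 1)) * ennpowr (?G w) s" for w :: real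
    have [measurable]: "h \<in> borel_measurable borel" unfolding h_def by measurable
    have [measurable]: "case_prod k \<in> borel_measurable (borel \<Otimes>\<^sub>M borel)"
      unfolding k_def by measurable
    define \<Psi> where "\<Psi> t = ennreal C1 * (\<integral>\<^sup>+w\<in>{0<..}. (k t w * h w) \<partial>lborel)" for t
    have \<Psi>: "ennpowr (rearrangement (R_op p q g) t) s \<le> \<Psi> t" if "0 < t" for t
    proof -
      have "rearrangement (R_op p q g) t \<le> ennpowr (\<Psi> t) (1 / s)"
      proof (rule rearrangement_upper[OF _ _ that])
        fix x :: real assume x: "0 < x"
        have "ennpowr (hardy p r ?G x) s \<le> \<Psi> x"
          unfolding \<Psi>_def k_def h_def C1_def \<alpha>_def \<gamma>_def
          using assms r e x a a\<gamma> by (intro hardy_powr_le rearrangement_antimono) (auto simp: \<gamma>_def)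
        then have "ennpowr (ennpowr (hardy p r ?G x) s) (1 / s) \<le> ennpowr (\<Psi> x) (1 / s)"
          using assms by (intro ennpowr_mono) auto
        then show "e2ennreal \<bar>R_op p q g x\<bar> \<le> ennpowr (\<Psi> x) (1 / s)"
          using assms by (simp add: r_def)
      next
        fix x y :: real assume xy: "0 < x" "x \<le> y"
        have "y powr - \<gamma> \<le> x powr - \<gamma>" using xy a a\<gamma> by (intro powr_mono2') auto
        then have "k y w \<le> k x w" for w
          unfolding k_def by (intro ennreal_leI) auto
        then have "\<Psi> y \<le> \<Psi> x"
          unfolding \<Psi>_def by (intro mult_left_mono nn_integral_mono mult_right_mono) auto
        then show "ennpowr (\<Psi> y) (1 / s) \<le> ennpowr (\<Psi> x) (1 / s)"
          using assms by (intro ennpowr_mono) auto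
      qed
      then have "ennpowr (rearrangement (R_op p q g) t) s \<le> ennpowr (ennpowr (\<Psi> t) (1 / s)) s"
        using assms by (intro ennpowr_mono) auto
      then show ?thesis using assms by simp
    qed
    have "lorentz_mass \<alpha>\<^sub>2 s (rearrangement (R_op p q g)) \<le>
        (\<integral>\<^sup>+t\<in>{0<..}. (ennreal (t powr (a - 1)) * \<Psi> t) \<partial>lborel)"
      unfolding lorentz_mass_def a_def
      by (intro nn_integral_mono) (auto simp: indicator_def intro!: mult_left_mono \<Psi>)
    \<comment> \<open>All factors, indicators included, go under both integrals so that the order of
      integration can be exchanged.\<close>
    also have "\<dots> = (\<integral>\<^sup>+t. (\<integral>\<^sup>+w. ennreal C1 * (ennreal (t powr (a - 1)) * indicator {0<..} t * k t w * (h w * indicator {0<..} w)) \<partial>lborel) \<partial>lborel)"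
      unfolding \<Psi>_def
      by (intro nn_integral_cong, subst nn_integral_cmult[symmetric], measurable,
          subst nn_integral_cmult[symmetric], measurable, subst nn_integral_multc[symmetric], measurable)
        (auto intro!: nn_integral_cong simp: ac_simps)
    also have "\<dots> = (\<integral>\<^sup>+w. (\<integral>\<^sup>+t. ennreal C1 * (ennreal (t powr (a - 1)) * indicator {0<..} t * k t w * (h w * indicator {0<..} w)) \<partial>lborel) \<partial>lborel)"
      by (rule lborel_pair.Fubini'[symmetric]) measurable
    also have "\<dots> = (\<integral>\<^sup>+w. ennreal C1 * ((\<integral>\<^sup>+t\<in>{0<..}. (ennreal (t powr (a - 1)) * k t w) \<partial>lborel) * (h w * indicator {0<..} w)) \<partial>lborel)"
      by (intro nn_integral_cong, subst nn_integral_multc[symmetric], measurable,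
          subst nn_integral_cmult[symmetric], measurable)
        (auto intro!: nn_integral_cong simp: ac_simps)
    also have "\<dots> \<le> (\<integral>\<^sup>+w. ennreal (C1 * C2) * (ennreal (w powr ((1 / q + \<alpha>\<^sub>2 / r) * s - 1)) * ennpowr (?G w) s * indicator {0<..} w) \<partial>lborel)"
    proof (intro nn_integral_mono)
      fix w :: real
      show "ennreal C1 * ((\<integral>\<^sup>+t\<in>{0<..}. (ennreal (t powr (a - 1)) * k t w) \<partial>lborel) * (h w * indicator {0<..} w))
        \<le> ennreal (C1 * C2) * (ennreal (w powr ((1 / q + \<alpha>\<^sub>2 / r) * s - 1)) * ennpowr (?G w) s * indicator {0<..} w)"
      proof (cases "0 < w")
        case True
        have "(\<integral>\<^sup>+t\<in>{0<..}. (ennreal (t powr (a - 1)) * k t w) \<partial>lborel) \<le> ennreal (C2 * w powr ((a - \<gamma>) / r))"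
          unfolding k_def C2_def using a a\<gamma> r True by (intro nn_integral_powr_min) auto
        then have "ennreal C1 * ((\<integral>\<^sup>+t\<in>{0<..}. (ennreal (t powr (a - 1)) * k t w) \<partial>lborel) * (h w * indicator {0<..} w))
          \<le> ennreal C1 * (ennreal (C2 * w powr ((a - \<gamma>) / r)) * (h w * indicator {0<..} w))"
          by (intro mult_left_mono mult_right_mono) auto
        also have "\<dots> = ennreal (C1 * C2) * (ennreal (w powr ((a - \<gamma>) / r) * w powr (\<alpha> * s - 1)) * ennpowr (?G w) s * indicator {0<..} w)"
          using C by (simp add: h_def ennreal_mult ac_simps)
        finally show ?thesis by (simp only: powr_add[symmetric] expo)
      qed simp
    qed
    also have "\<dots> = ennreal (C1 * C2) * lorentz_mass (1 / q + \<alpha>\<^sub>2 / r) s ?G"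
      unfolding lorentz_mass_def by (subst nn_integral_cmult) auto
    finally show ?thesis .
  qed
  show ?thesis using that[of "C1 * C2"] C bound by simp
qed

section \<open>Sufficiency\<close>

text \<open>The weak norm bounds the rearrangement of \<open>g\<close> almost everywhere by a
  multiple of \<open>w powr - \<alpha>\<^sub>1\<close>, and inserting this into the inner integral
  yields a pure power of \<open>t\<close>. The value \<open>\<alpha>\<^sub>2 = 0\<close> is included
  for an infinite \<open>r\<^sub>2\<close>.\<close>

lemma R_op_weak_bound:
  assumes "0 < p" "p < q" "0 \<le> \<alpha>\<^sub>2" "\<alpha>\<^sub>2 < 1 / p"
  defines "r \<equiv> q / (q - p)"
  assumes a: "real_of_ereal (1 / a\<^sub>1) = 1 / q + \<alpha>\<^sub>2 / r" "real_of_ereal (1 / a\<^sub>2) = \<alpha>\<^sub>2"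
  shows "\<exists>K>0. \<forall>g. lorentz_norm a\<^sub>2 \<infinity> (R_op p q g) \<le> ennreal K * lorentz_norm a\<^sub>1 \<infinity> g"
proof -
  have r: "1 < r" using assms by (simp add: r_def field_simps)
  define \<alpha>\<^sub>1 where "\<alpha>\<^sub>1 = 1 / q + \<alpha>\<^sub>2 / r"
  define c where "c = 1 - \<alpha>\<^sub>1 * p"
  \<comment> \<open>The exponent relation in the form needed twice: it shows \<open>c > 0\<close>,
    so that the inner integral converges at 0, and it turns \<open>(x powr r) powr c / x\<close>
    into \<open>x powr (- (\<alpha>\<^sub>2 * p))\<close>.\<close>
  have rc: "r * c = 1 - \<alpha>\<^sub>2 * p"
    using assms(1,2) unfolding c_def \<alpha>\<^sub>1_def r_def by (simp add: field_simps)
  have "\<alpha>\<^sub>2 * p < 1" using assms by (simp add: field_simps)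
  then have c: "0 < c" using rc r by (smt (verit) mult_nonneg_nonpos)
  have "lorentz_norm a\<^sub>2 \<infinity> (R_op p q g) \<le> ennreal ((1 / c) powr (1 / p)) * lorentz_norm a\<^sub>1 \<infinity> g" for g
  proof (rule lorentz_norm_infinity_le)
    fix t :: real assume t: "0 < t"
    let ?G = "rearrangement g" and ?A = "lorentz_norm a\<^sub>1 \<infinity> g"
    let ?\<Phi> = "\<lambda>t. ennreal (t powr - \<alpha>\<^sub>2 * (1 / c) powr (1 / p)) * ?A"
    have hardy: "hardy p r ?G x \<le> ?\<Phi> x" if x: "0 < x" for x
    proof -
      have "(\<integral>\<^sup>+w\<in>{0<..<x powr r}. ennpowr (?G w) p \<partial>lborel) \<le>
          (\<integral>\<^sup>+w. ennreal (w powr (c - 1)) * indicator {0<..<x powr r} w * ennpowr ?A p \<partial>lborel)"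
      proof (rule nn_integral_mono_AE, rule eventually_mono[OF lorentz_norm_infinity_AE[of a\<^sub>1 g]])
        fix w :: real
        assume w: "0 < w \<longrightarrow> ennreal (w powr real_of_ereal (1 / a\<^sub>1)) * ?G w \<le> ?A"
        show "ennpowr (?G w) p * indicator {0<..<x powr r} w \<le>
          ennreal (w powr (c - 1)) * indicator {0<..<x powr r} w * ennpowr ?A p"
        proof (cases "w \<in> {0<..<x powr r}")
          case True
          then have "ennpowr (ennreal (w powr \<alpha>\<^sub>1) * ?G w) p \<le> ennpowr ?A p"
            using w a assms(1) by (intro ennpowr_mono) (auto simp: \<alpha>\<^sub>1_def)
          then have "ennreal (w powr (c - 1)) * (ennreal (w powr (\<alpha>\<^sub>1 * p)) * ennpowr (?G w) p) \<le>
              ennreal (w powr (c - 1)) * ennpowr ?A p"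
            using assms(1) by (intro mult_left_mono) (simp_all add: ennpowr_mult powr_powr)
          moreover have "ennreal (w powr (c - 1)) * ennreal (w powr (\<alpha>\<^sub>1 * p)) = 1"
            using True by (simp add: c_def ennreal_mult[symmetric] powr_add[symmetric])
          ultimately show ?thesis using True by (simp add: mult.assoc[symmetric])
        qed simp
      qed
      also have "\<dots> = ennreal ((x powr r) powr c / c) * ennpowr ?A p"
        using c by (subst nn_integral_multc) (auto simp: nn_integral_powr_0)
      finally have "ennreal (1 / x) * (\<integral>\<^sup>+w\<in>{0<..<x powr r}. ennpowr (?G w) p \<partial>lborel) \<le>
          ennreal (1 / x) * (ennreal ((x powr r) powr c / c) * ennpowr ?A p)"
        by (rule mult_left_mono) simp
      also have "\<dots> = ennreal (x powr (- (\<alpha>\<^sub>2 * p)) * (1 / c)) * ennpowr ?A p"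
      proof -
        have "1 / x * ((x powr r) powr c / c) = x powr (- (\<alpha>\<^sub>2 * p)) * (1 / c)"
          using x c unfolding powr_powr rc by (simp add: powr_diff powr_minus field_simps)
        then show ?thesis
          using x c by (simp only: mult.assoc[symmetric]) (simp add: ennreal_mult[symmetric])
      qed
      finally have "hardy p r ?G x \<le> ennpowr (ennreal (x powr (- (\<alpha>\<^sub>2 * p)) * (1 / c)) * ennpowr ?A p) (1 / p)"
        unfolding hardy_def using assms(1) by (intro ennpowr_mono) auto
      also have "\<dots> = ?\<Phi> x"
        using assms(1) c by (simp add: ennpowr_mult powr_mult powr_powr powr_divide)
      finally show ?thesis .
    qed
    have "rearrangement (R_op p q g) t \<le> ?\<Phi> t"
    proof (rule rearrangement_upper[OF _ _ t])
      show "e2ennreal \<bar>R_op p q g x\<bar> \<le> ?\<Phi> x" if "0 < x" for x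
        using hardy[OF that] by (simp add: r_def)
      show "?\<Phi> y \<le> ?\<Phi> x" if "0 < x" "x \<le> y" for x y
        using that assms by (intro mult_right_mono ennreal_leI powr_mono2') auto
    qed
    then have "ennreal (t powr \<alpha>\<^sub>2) * rearrangement (R_op p q g) t \<le> ennreal (t powr \<alpha>\<^sub>2) * ?\<Phi> t"
      by (rule mult_left_mono) simp
    also have "\<dots> = ennreal ((1 / c) powr (1 / p)) * ?A"
    proof -
      have "t powr \<alpha>\<^sub>2 * t powr - \<alpha>\<^sub>2 = 1"
        using t by (simp add: powr_add[symmetric])
      then show ?thesis by (simp add: mult.assoc[symmetric] ennreal_mult[symmetric])
    qed
    finally show "ennreal (t powr real_of_ereal (1 / a\<^sub>2)) * rearrangement (R_op p q g) t
      \<le> ennreal ((1 / c) powr (1 / p)) * ?A" by (simp add: a)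
  qed
  then show ?thesis using c by (intro exI[of _ "(1 / c) powr (1 / p)"]) auto
qed

text \<open>For first and second index \<open>p\<close> the weight is constant, so extending the
  inner integral to the half-line gives exactly the \<open>p\<close>-th power of the norm. Hence
  \<open>R_op p q g t\<close> is at most \<open>t powr - (1 / p)\<close> times the norm.\<close>

lemma R_op_endpoint_bound:
  assumes "1 \<le> p" "p < q"
  shows "lorentz_norm (ereal p) \<infinity> (R_op p q g) \<le> lorentz_norm (ereal p) (ereal p) g"
proof (rule lorentz_norm_infinity_le)
  fix t :: real assume t: "0 < t"
  define A where "A = lorentz_mass (1 / p) p (rearrangement g)"
  let ?\<Phi> = "\<lambda>t. ennreal (t powr - (1 / p)) * ennpowr A (1 / p)"
  have "rearrangement (R_op p q g) t \<le> ?\<Phi> t"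
  proof (rule rearrangement_upper[OF _ _ t])
    fix x :: real assume x: "0 < x"
    have "(\<integral>\<^sup>+w\<in>{0<..<x powr (q / (q - p))}. ennpowr (rearrangement g w) p \<partial>lborel) \<le> A"
      unfolding A_def lorentz_mass_def using assms
      by (intro nn_integral_mono) (auto simp: indicator_def)
    then have "hardy p (q / (q - p)) (rearrangement g) x \<le> ennpowr (ennreal (1 / x) * A) (1 / p)"
      unfolding hardy_def using assms by (intro ennpowr_mono mult_left_mono) auto
    also have "\<dots> = ?\<Phi> x"
      using assms x by (simp add: ennpowr_mult powr_minus powr_divide divide_simps)
    finally show "e2ennreal \<bar>R_op p q g x\<bar> \<le> ?\<Phi> x" by simp
  next
    show "?\<Phi> y \<le> ?\<Phi> x" if "0 < x" "x \<le> y" for x y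
      using that assms by (intro mult_right_mono ennreal_leI powr_mono2') auto
  qed
  then have "ennreal (t powr (1 / p)) * rearrangement (R_op p q g) t \<le> ennreal (t powr (1 / p)) * ?\<Phi> t"
    by (rule mult_left_mono) simp
  also have "\<dots> = ennpowr A (1 / p)"
    using t by (simp add: mult.assoc[symmetric] ennreal_mult[symmetric] powr_add[symmetric])
  finally show "ennreal (t powr real_of_ereal (1 / ereal p)) * rearrangement (R_op p q g) t \<le>
      lorentz_norm (ereal p) (ereal p) g"
    using assms by (simp add: lorentz_norm_finite A_def)
qed

text \<open>Each case of the sufficiency is proved for one convenient second index \<open>b\<close>
  in the domain; the embedding of Lorentz spaces supplies the rest.\<close>

lemma lorentz_boundedI:
  assumes "\<exists>K>0. \<forall>g. lorentz_norm a\<^sub>2 b\<^sub>2 (T g) \<le> ennreal K * lorentz_norm a\<^sub>1 b g"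
    and "\<exists>K>0. \<forall>g. lorentz_norm a\<^sub>1 b g \<le> ennreal K * lorentz_norm a\<^sub>1 b\<^sub>1 g"
  shows "lorentz_bounded T a\<^sub>1 b\<^sub>1 a\<^sub>2 b\<^sub>2"
proof -
  obtain K L where KL: "0 < K" "0 < L"
    "\<And>g. lorentz_norm a\<^sub>2 b\<^sub>2 (T g) \<le> ennreal K * lorentz_norm a\<^sub>1 b g"
    "\<And>g. lorentz_norm a\<^sub>1 b g \<le> ennreal L * lorentz_norm a\<^sub>1 b\<^sub>1 g"
    using assms by auto
  have "lorentz_norm a\<^sub>2 b\<^sub>2 (T g) \<le> ennreal (K * L) * lorentz_norm a\<^sub>1 b\<^sub>1 g" for g
  proof -
    have "lorentz_norm a\<^sub>2 b\<^sub>2 (T g) \<le> ennreal K * (ennreal L * lorentz_norm a\<^sub>1 b\<^sub>1 g)"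
      using KL(3)[of g] mult_left_mono[OF KL(4)[of g], of "ennreal K"] by (auto intro: order_trans)
    then show ?thesis using KL by (simp add: ennreal_mult mult.assoc)
  qed
  then show ?thesis
    unfolding lorentz_bounded_def using KL by (intro exI[of _ "K * L"]) auto
qed

text \<open>Exponents are compared as real reciprocals, with 0 for an infinite index; this is the
  bridge to the extended-real relation in the theorem.\<close>

lemma ereal_inverse_eq_iff:
  assumes "1 \<le> r\<^sub>1" "1 \<le> r\<^sub>2" "0 < q" "0 < r"
  shows "1 / ereal q + 1 / (ereal r * r\<^sub>2) = 1 / r\<^sub>1 \<longleftrightarrow>
    real_of_ereal (1 / r\<^sub>1) = 1 / q + real_of_ereal (1 / r\<^sub>2) / r"
  using assms by (cases r\<^sub>1; cases r\<^sub>2) (auto simp: one_ereal_def zero_ereal_def field_simps)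

lemma R_op_bounded:
  assumes "1 \<le> r\<^sub>1" "1 \<le> r\<^sub>2" "1 \<le> s\<^sub>1" "1 \<le> s\<^sub>2" "1 < p" "p < q" and r: "r = q / (q - p)"
    and "(ereal p < r\<^sub>1 \<and> r\<^sub>1 < ereal q \<and> s\<^sub>1 \<le> s\<^sub>2 \<and> 1 / ereal q + 1 / (ereal r * r\<^sub>2) = 1 / r\<^sub>1) \<or>
     (r\<^sub>1 = ereal p \<and> r\<^sub>2 = ereal p \<and> s\<^sub>1 \<le> ereal p \<and> s\<^sub>2 = \<infinity>) \<or>
     (r\<^sub>1 = ereal q \<and> r\<^sub>2 = \<infinity> \<and> s\<^sub>2 = \<infinity>)"
  shows "lorentz_bounded (R_op p q) r\<^sub>1 s\<^sub>1 r\<^sub>2 s\<^sub>2"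
  using assms(8)
proof (elim disjE conjE)
  assume A: "ereal p < r\<^sub>1" "r\<^sub>1 < ereal q" "s\<^sub>1 \<le> s\<^sub>2" "1 / ereal q + 1 / (ereal r * r\<^sub>2) = 1 / r\<^sub>1"
  define \<alpha>\<^sub>2 where "\<alpha>\<^sub>2 = real_of_ereal (1 / r\<^sub>2)"
  have r0: "0 < r" using assms by simp
  have \<alpha>1: "real_of_ereal (1 / r\<^sub>1) = 1 / q + \<alpha>\<^sub>2 / r"
    using A assms r0 by (subst (asm) ereal_inverse_eq_iff) (auto simp: \<alpha>\<^sub>2_def)
  obtain \<rho> where \<rho>: "r\<^sub>1 = ereal \<rho>" "p < \<rho>" "\<rho> < q" using A by (cases r\<^sub>1) auto
  have *: "1 / q + \<alpha>\<^sub>2 / r = 1 / \<rho>" using \<alpha>1 \<rho> by simp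
  \<comment> \<open>Under the exponent relation, \<open>p < \<rho> < q\<close> says the same as
    \<open>0 < \<alpha>\<^sub>2 < 1 / p\<close>.\<close>
  have lo: "1 / q < 1 / \<rho>" and hi: "1 / \<rho> < 1 / p"
    using \<rho> assms by (auto simp: frac_less2)
  have "0 < \<alpha>\<^sub>2 / r" using * lo by linarith
  then have \<alpha>pos: "0 < \<alpha>\<^sub>2" using r0 by (simp add: zero_less_divide_iff)
  have "\<alpha>\<^sub>2 / r < 1 / p - 1 / q" using * hi by linarith
  also have "\<dots> = (1 / p) / r" using assms(5,6) unfolding r by (simp add: field_simps)
  finally have \<alpha>lt: "\<alpha>\<^sub>2 < 1 / p" using r0 by (metis divide_less_cancel)
  have "\<exists>K>0. \<forall>g. lorentz_norm r\<^sub>2 s\<^sub>2 (R_op p q g) \<le> ennreal K * lorentz_norm r\<^sub>1 s\<^sub>2 g"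
  proof (cases "s\<^sub>2 = \<infinity>")
    case True
    then show ?thesis
      using R_op_weak_bound[OF _ assms(6) _ \<alpha>lt \<alpha>1[unfolded r] \<alpha>\<^sub>2_def[symmetric]] assms(5) \<alpha>pos
      by simp
  next
    case False
    then obtain b where b: "s\<^sub>2 = ereal b" "1 \<le> b"
      using assms(4) by (cases s\<^sub>2) (auto simp: one_ereal_def)
    obtain K where K: "0 < K" "\<And>g. lorentz_mass \<alpha>\<^sub>2 b (rearrangement (R_op p q g)) \<le>
        ennreal K * lorentz_mass (1 / q + \<alpha>\<^sub>2 / r) b (rearrangement g)"
      using lorentz_mass_R_op_le[OF _ assms(6) _ \<alpha>pos \<alpha>lt, of b] assms(5) b(2) unfolding r by auto
    have "lorentz_norm r\<^sub>2 s\<^sub>2 (R_op p q g) \<le> ennreal (K powr (1 / b)) * lorentz_norm r\<^sub>1 s\<^sub>2 g" for g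
    proof -
      have "ennpowr (lorentz_mass \<alpha>\<^sub>2 b (rearrangement (R_op p q g))) (1 / b) \<le>
          ennpowr (ennreal K * lorentz_mass (1 / q + \<alpha>\<^sub>2 / r) b (rearrangement g)) (1 / b)"
        using b K by (intro ennpowr_mono) auto
      then show ?thesis
        using b K assms(1,2) \<alpha>1 by (simp add: lorentz_norm_finite ennpowr_mult \<alpha>\<^sub>2_def)
    qed
    then show ?thesis using K by (intro exI[of _ "K powr (1 / b)"]) auto
  qed
  moreover have "\<exists>K>0. \<forall>g. lorentz_norm r\<^sub>1 s\<^sub>2 g \<le> ennreal K * lorentz_norm r\<^sub>1 s\<^sub>1 g"
    using assms A \<rho> by (intro lorentz_embedding) auto
  ultimately show ?thesis by (rule lorentz_boundedI)
next
  assume A: "r\<^sub>1 = ereal p" "r\<^sub>2 = ereal p" "s\<^sub>1 \<le> ereal p" "s\<^sub>2 = \<infinity>"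
  \<comment> \<open>The intermediate second index is \<open>p\<close>, with constant 1.\<close>
  have "\<exists>K>0. \<forall>g. lorentz_norm r\<^sub>2 s\<^sub>2 (R_op p q g) \<le> ennreal K * lorentz_norm r\<^sub>1 (ereal p) g"
    using R_op_endpoint_bound[of p q] assms(5,6) A by (intro exI[of _ 1]) auto
  moreover have "\<exists>K>0. \<forall>g. lorentz_norm r\<^sub>1 (ereal p) g \<le> ennreal K * lorentz_norm r\<^sub>1 s\<^sub>1 g"
    using assms A by (intro lorentz_embedding) auto
  ultimately show ?thesis by (rule lorentz_boundedI)
next
  assume A: "r\<^sub>1 = ereal q" "r\<^sub>2 = \<infinity>" "s\<^sub>2 = \<infinity>"
  \<comment> \<open>Here \<open>\<alpha>\<^sub>2 = 0\<close>, and the intermediate space is the weak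
    one, into which every \<open>s\<^sub>1\<close> embeds.\<close>
  have "\<exists>K>0. \<forall>g. lorentz_norm r\<^sub>2 s\<^sub>2 (R_op p q g) \<le> ennreal K * lorentz_norm r\<^sub>1 \<infinity> g"
    using R_op_weak_bound[of p q 0 r\<^sub>1 r\<^sub>2] assms(5,6) A by simp
  moreover have "\<exists>K>0. \<forall>g. lorentz_norm r\<^sub>1 \<infinity> g \<le> ennreal K * lorentz_norm r\<^sub>1 s\<^sub>1 g"
    using assms A by (intro lorentz_embedding) auto
  ultimately show ?thesis by (rule lorentz_boundedI)
qed

section \<open>Test functions\<close>

text \<open>For \<open>\<alpha> = 0\<close> this is, on the half-line, the indicator function of \<open>(0, N)\<close>.\<close>

definition trunc_power :: "real \<Rightarrow> real \<Rightarrow> real \<Rightarrow> real" where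
  "trunc_power \<alpha> N x = (if x < N then min 1 (x powr - \<alpha>) else 0)"

abbreviation test_fun :: "real \<Rightarrow> real \<Rightarrow> real \<Rightarrow> ereal" where
  "test_fun \<alpha> N \<equiv> \<lambda>x. ereal (trunc_power \<alpha> N x)"

lemma trunc_power_nonneg [simp]: "0 \<le> trunc_power \<alpha> N x"
  by (simp add: trunc_power_def)

lemma trunc_power_antimono:
  "0 \<le> \<alpha> \<Longrightarrow> 0 < x \<Longrightarrow> x \<le> y \<Longrightarrow> trunc_power \<alpha> N y \<le> trunc_power \<alpha> N x"
  by (auto simp: trunc_power_def min_le_iff_disj intro: powr_mono2')

lemma test_fun_meas_funs: "test_fun \<alpha> N \<in> meas_funs"
  unfolding meas_funs_def trunc_power_def by (rule borel_halfline) measurable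

lemma rearrangement_test_fun_le:
  "0 \<le> \<alpha> \<Longrightarrow> 0 < t \<Longrightarrow> rearrangement (test_fun \<alpha> N) t \<le> ennreal (trunc_power \<alpha> N t)"
  by (intro rearrangement_upper) (auto intro: trunc_power_antimono)

text \<open>A nonincreasing function is its own rearrangement up to values at jumps. The strict gap
  between \<open>t\<close> and \<open>u\<close> is inherited from \<open>rearrangement_lower\<close>
  and costs at most a constant factor later on.\<close>

lemma rearrangement_test_fun_ge:
  assumes "0 \<le> \<alpha>" "0 \<le> t" "t < u"
  shows "ennreal (trunc_power \<alpha> N u) \<le> rearrangement (test_fun \<alpha> N) t"
  using test_fun_meas_funs[of \<alpha> N] assms unfolding meas_funs_def
  by (intro rearrangement_lower[of _ 0 u]) (auto intro: trunc_power_antimono)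

text \<open>The rearrangement is at most the indicator of \<open>(0, N)\<close>, whose norm is a
  constant times the power of \<open>N\<close> dictated by scaling.\<close>

lemma lorentz_norm_indicator_le:
  assumes "1 \<le> a" "1 \<le> s" "a < \<infinity> \<or> s = \<infinity>"
  obtains K where "0 < K" "\<And>N. 0 < N \<Longrightarrow>
    lorentz_norm a s (test_fun 0 N) \<le> ennreal (K * N powr real_of_ereal (1 / a))"
proof -
  define \<alpha> where "\<alpha> = real_of_ereal (1 / a)"
  have \<alpha>0: "0 \<le> \<alpha>"
    unfolding \<alpha>_def by (intro real_of_ereal_inverse_nonneg assms)
  have upper: "rearrangement (test_fun 0 N) t \<le> indicator {0<..<N} t" if "0 < t" for N t
    using rearrangement_test_fun_le[of 0 t N] that by (auto simp: trunc_power_def indicator_def)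
  show ?thesis
  proof (cases "s = \<infinity>")
    case True
    have "lorentz_norm a s (test_fun 0 N) \<le> ennreal (1 * N powr real_of_ereal (1 / a))" if "0 < N" for N
      unfolding True
    proof (rule lorentz_norm_infinity_le)
      fix t :: real assume t: "0 < t"
      have "ennreal (t powr \<alpha>) * rearrangement (test_fun 0 N) t \<le> ennreal (t powr \<alpha>) * indicator {0<..<N} t"
        using upper[OF t] by (intro mult_left_mono) auto
      also have "\<dots> \<le> ennreal (N powr \<alpha>)"
        using t \<alpha>0 by (auto simp: indicator_def intro!: ennreal_leI powr_mono2)
      finally show "ennreal (t powr real_of_ereal (1 / a)) * rearrangement (test_fun 0 N) t \<le> ennreal (1 * N powr real_of_ereal (1 / a))"
        by (simp add: \<alpha>_def)
    qed
    then show ?thesis using that[of 1] by simp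
  next
    case False
    then obtain b where b: "s = ereal b" "1 \<le> b"
      using assms by (cases s) (auto simp: one_ereal_def)
    have \<alpha>: "0 < \<alpha>"
      using False assms unfolding \<alpha>_def by (intro real_of_ereal_inverse_pos) auto
    have "lorentz_norm a s (test_fun 0 N) \<le> ennreal ((1 / (\<alpha> * b)) powr (1 / b) * N powr real_of_ereal (1 / a))"
      if N: "0 < N" for N
    proof -
      have "lorentz_mass \<alpha> b (rearrangement (test_fun 0 N)) \<le>
          (\<integral>\<^sup>+t\<in>{0<..<N}. ennreal (t powr (\<alpha> * b - 1)) \<partial>lborel)"
        unfolding lorentz_mass_def
      proof (rule nn_integral_mono)
        fix t :: real
        have "ennpowr (rearrangement (test_fun 0 N) t) b \<le> indicator {0<..<N} t" if "0 < t"
          using ennpowr_mono[OF upper[OF that, of N], of b] b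
          by (cases "t < N") (auto simp: indicator_def simp flip: ennreal_1)
        then show "ennreal (t powr (\<alpha> * b - 1)) * ennpowr (rearrangement (test_fun 0 N) t) b * indicator {0<..} t
          \<le> ennreal (t powr (\<alpha> * b - 1)) * indicator {0<..<N} t"
          by (cases "0 < t") (auto intro: mult_left_mono)
      qed
      also have "\<dots> = ennreal (N powr (\<alpha> * b) / (\<alpha> * b))"
        using N \<alpha> b by (subst nn_integral_powr_0) auto
      finally have "ennpowr (lorentz_mass \<alpha> b (rearrangement (test_fun 0 N))) (1 / b)
          \<le> ennpowr (ennreal (N powr (\<alpha> * b) / (\<alpha> * b))) (1 / b)"
        using b by (intro ennpowr_mono) auto
      also have "\<dots> = ennreal ((1 / (\<alpha> * b)) powr (1 / b) * N powr \<alpha>)"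
        using \<alpha> b N by (simp add: powr_divide powr_powr)
      finally show ?thesis
        using assms b by (simp add: lorentz_norm_finite \<alpha>_def)
    qed
    then show ?thesis using that[of "(1 / (\<alpha> * b)) powr (1 / b)"] \<alpha> b by simp
  qed
qed

text \<open>The decay rate is the reciprocal of the first index, so that weight and function combine
  to \<open>1 / t\<close> on \<open>(1, N)\<close> and produce the logarithm. On
  \<open>(0, 1)\<close> the function is at most 1 and the weight is integrable; the summand 1 next
  to \<open>ln N\<close> absorbs this part.\<close>

lemma lorentz_norm_trunc_power_le:
  assumes "1 \<le> a" "a < \<infinity>" "1 \<le> s"
  defines "\<alpha> \<equiv> real_of_ereal (1 / a)"
  obtains K where "0 < K" "\<And>N. 1 \<le> N \<Longrightarrow>
    lorentz_norm a s (test_fun \<alpha> N) \<le> ennreal (K * (1 + ln N) powr real_of_ereal (1 / s))"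
proof -
  have \<alpha>: "0 < \<alpha>"
    using assms(1,2) unfolding \<alpha>_def by (intro real_of_ereal_inverse_pos) auto
  have upper: "rearrangement (test_fun \<alpha> N) t \<le> ennreal (trunc_power \<alpha> N t)" if "0 < t" for N t
    using \<alpha> that by (intro rearrangement_test_fun_le) auto
  show ?thesis
  proof (cases "s = \<infinity>")
    case True
    have "lorentz_norm a s (test_fun \<alpha> N) \<le> 1" for N
      unfolding True
    proof (rule lorentz_norm_infinity_le)
      fix t :: real assume t: "0 < t"
      have "ennreal (t powr \<alpha>) * rearrangement (test_fun \<alpha> N) t \<le> ennreal (t powr \<alpha>) * ennreal (t powr - \<alpha>)"
        using upper[OF t, of N]
        by (intro mult_left_mono) (auto intro: order_trans ennreal_leI simp: trunc_power_def split: if_splits)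
      also have "\<dots> = 1" using t by (simp add: ennreal_mult[symmetric] powr_add[symmetric])
      finally show "ennreal (t powr real_of_ereal (1 / a)) * rearrangement (test_fun \<alpha> N) t \<le> 1"
        by (simp add: \<alpha>_def)
    qed
    \<comment> \<open>The exponent is 0 here, and \<open>x powr 0\<close> is 1 because
      \<open>x = 1 + ln N\<close> is not 0.\<close>
    then show ?thesis using that[of 1] True by (simp add: add_nonneg_eq_0_iff)
  next
    case False
    then obtain b where b: "s = ereal b" "1 \<le> b"
      using assms by (cases s) (auto simp: one_ereal_def)
    \<comment> \<open>Chosen so that
      \<open>1 / (\<alpha> * b) + ln N \<le> K * (1 + ln N)\<close>.\<close>
    define K where "K = 1 + 1 / (\<alpha> * b)"
    have K: "1 \<le> K" using \<alpha> b by (simp add: K_def)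
    have "lorentz_norm a s (test_fun \<alpha> N) \<le> ennreal (K powr (1 / b) * (1 + ln N) powr real_of_ereal (1 / s))"
      if N: "1 \<le> N" for N
    proof -
      have ln: "0 \<le> ln N" using N by simp
      have "lorentz_mass \<alpha> b (rearrangement (test_fun \<alpha> N)) \<le>
          (\<integral>\<^sup>+t. ennreal (t powr (\<alpha> * b - 1)) * indicator {0<..<1} t + ennreal (t powr - 1) * indicator {1<..<N} t \<partial>lborel)"
        unfolding lorentz_mass_def
      \<comment> \<open>The point 1 lies in neither open interval, so the comparison holds only
        almost everywhere.\<close>
      proof (rule nn_integral_mono_AE, rule eventually_mono[OF AE_lborel_singleton[of 1]])
        fix t :: real assume t1: "t \<noteq> 1"
        show "ennreal (t powr (\<alpha> * b - 1)) * ennpowr (rearrangement (test_fun \<alpha> N) t) b * indicator {0<..} t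
          \<le> ennreal (t powr (\<alpha> * b - 1)) * indicator {0<..<1} t + ennreal (t powr - 1) * indicator {1<..<N} t"
        proof (cases "0 < t")
          case True
          have "ennpowr (rearrangement (test_fun \<alpha> N) t) b \<le> ennreal (trunc_power \<alpha> N t powr b)"
            using ennpowr_mono[OF upper[OF True, of N], of b] b by simp
          then have "ennreal (t powr (\<alpha> * b - 1)) * ennpowr (rearrangement (test_fun \<alpha> N) t) b \<le>
              ennreal (t powr (\<alpha> * b - 1) * trunc_power \<alpha> N t powr b)"
            by (simp add: ennreal_mult mult_left_mono)
          also have "\<dots> \<le> ennreal (t powr (\<alpha> * b - 1)) * indicator {0<..<1} t + ennreal (t powr - 1) * indicator {1<..<N} t"
          proof (cases "t < 1")
            case True
            then have "trunc_power \<alpha> N t powr b \<le> 1"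
              using b by (intro powr_le1) (auto simp: trunc_power_def)
            then have "t powr (\<alpha> * b - 1) * trunc_power \<alpha> N t powr b \<le> t powr (\<alpha> * b - 1) * 1"
              by (intro mult_left_mono) auto
            then show ?thesis using \<open>0 < t\<close> True by (simp add: ennreal_leI)
          next
            case False
            have "trunc_power \<alpha> N t powr b \<le> t powr - (\<alpha> * b)" if "t < N"
              using powr_mono2[of b "trunc_power \<alpha> N t" "t powr - \<alpha>"] that b
              by (simp add: trunc_power_def powr_powr)
            then have "t powr (\<alpha> * b - 1) * trunc_power \<alpha> N t powr b \<le> t powr - 1" if "t < N"
              using mult_left_mono[of "trunc_power \<alpha> N t powr b" "t powr - (\<alpha> * b)" "t powr (\<alpha> * b - 1)"] that
              by (simp add: powr_add[symmetric])
            moreover have "trunc_power \<alpha> N t = 0" if "\<not> t < N" using that by (simp add: trunc_power_def)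
            ultimately show ?thesis using False t1
              by (cases "t < N") (auto simp: ennreal_leI)
          qed
          finally show ?thesis using True by simp
        qed simp
      qed
      also have "\<dots> = ennreal (1 / (\<alpha> * b)) + ennreal (ln N)"
        using N \<alpha> b nn_integral_powr_0[of "\<alpha> * b" 1] nn_integral_inverse[OF N]
        by (subst nn_integral_add) auto
      also have "\<dots> = ennreal (1 / (\<alpha> * b) + ln N)"
        using \<alpha> b ln by (simp add: ennreal_plus)
      also have "\<dots> \<le> ennreal (K * (1 + ln N))"
      proof (rule ennreal_leI)
        show "1 / (\<alpha> * b) + ln N \<le> K * (1 + ln N)"
          using \<alpha> b ln by (simp add: K_def distrib_left distrib_right)
      qed
      finally have "ennpowr (lorentz_mass \<alpha> b (rearrangement (test_fun \<alpha> N))) (1 / b)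
          \<le> ennpowr (ennreal (K * (1 + ln N))) (1 / b)"
        using b by (intro ennpowr_mono) auto
      also have "\<dots> = ennreal (K powr (1 / b) * (1 + ln N) powr (1 / b))"
        using K ln by (simp add: powr_mult)
      finally show ?thesis
        using assms(1) b by (simp add: lorentz_norm_finite \<alpha>_def)
    qed
    then show ?thesis using that[of "K powr (1 / b)"] K by simp
  qed
qed

text \<open>The counterpart of the previous bound: the \<open>b\<close>-th power of the assumed
  decay cancels the weight down to \<open>1 / t\<close>.\<close>

lemma lorentz_norm_log_lower:
  assumes "1 \<le> a" "0 < b" "1 \<le> N" "0 \<le> c"
    and G: "\<And>t. 1 < t \<Longrightarrow> t < N \<Longrightarrow>
      ennreal (c * t powr - real_of_ereal (1 / a)) \<le> rearrangement f t"
  shows "ennreal (c * ln N powr (1 / b)) \<le> lorentz_norm a (ereal b) f"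
proof -
  define \<alpha> where "\<alpha> = real_of_ereal (1 / a)"
  have "ennreal (c powr b) * ennreal (ln N) =
      ennreal (c powr b) * (\<integral>\<^sup>+t\<in>{1<..<N}. ennreal (t powr - 1) \<partial>lborel)"
    using assms(3) by (subst nn_integral_inverse) auto
  also have "\<dots> = (\<integral>\<^sup>+t. ennreal (c powr b) * (ennreal (t powr - 1) * indicator {1<..<N} t) \<partial>lborel)"
    by (subst nn_integral_cmult) auto
  also have "\<dots> \<le> lorentz_mass \<alpha> b (rearrangement f)"
    unfolding lorentz_mass_def
  proof (rule nn_integral_mono)
    fix t :: real
    show "ennreal (c powr b) * (ennreal (t powr - 1) * indicator {1<..<N} t) \<le>
      ennreal (t powr (\<alpha> * b - 1)) * ennpowr (rearrangement f t) b * indicator {0<..} t"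
    proof (cases "t \<in> {1<..<N}")
      case True
      have "ennpowr (ennreal (c * t powr - \<alpha>)) b \<le> ennpowr (rearrangement f t) b"
        using G[of t] True assms(2) by (intro ennpowr_mono) (auto simp: \<alpha>_def)
      then have "ennreal (t powr (\<alpha> * b - 1)) * ennreal (c powr b * t powr - (\<alpha> * b)) \<le>
          ennreal (t powr (\<alpha> * b - 1)) * ennpowr (rearrangement f t) b"
        using assms(4) by (intro mult_left_mono) (simp_all add: powr_mult powr_powr)
      moreover have "t powr (\<alpha> * b - 1) * (c powr b * t powr - (\<alpha> * b)) = c powr b * t powr - 1"
        by (simp only: mult.left_commute[of _ "c powr b"] powr_add[symmetric]) simp
      ultimately show ?thesis using True by (simp add: ennreal_mult[symmetric])
    qed simp
  qed
  finally have "ennpowr (ennreal (c powr b) * ennreal (ln N)) (1 / b)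
      \<le> ennpowr (lorentz_mass \<alpha> b (rearrangement f)) (1 / b)"
    using assms(2) by (intro ennpowr_mono) auto
  then show ?thesis
    using assms(1-4) by (simp add: lorentz_norm_finite \<alpha>_def ennpowr_mult powr_powr ennreal_mult)
qed

section \<open>Lower bounds for averages, and growth of powers\<close>

lemma hardy_lower:
  assumes "0 < p" "0 < t" "0 \<le> I"
    and "ennreal I \<le> (\<integral>\<^sup>+w\<in>{0<..<t powr r}. ennpowr (G w) p \<partial>lborel)"
  shows "ennreal ((I / t) powr (1 / p)) \<le> hardy p r G t"
proof -
  have "ennpowr (ennreal (1 / t) * ennreal I) (1 / p) \<le> hardy p r G t"
    unfolding hardy_def using assms by (intro ennpowr_mono mult_left_mono) auto
  then show ?thesis using assms by (simp add: ennreal_mult[symmetric])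
qed

lemma nn_integral_ennpowr_ge_const:
  assumes "0 < p" "0 \<le> c" "0 \<le> N" "N \<le> T" "\<And>w. 0 < w \<Longrightarrow> w < N \<Longrightarrow> ennreal c \<le> G w"
  shows "ennreal (c powr p * N) \<le> (\<integral>\<^sup>+w\<in>{0<..<T}. ennpowr (G w) p \<partial>lborel)"
proof -
  have "ennreal (c powr p * N) = (\<integral>\<^sup>+w. ennreal (c powr p) * indicator {0<..<N} w \<partial>lborel)"
    using assms by (subst nn_integral_cmult_indicator) (auto simp: ennreal_mult)
  also have "\<dots> \<le> (\<integral>\<^sup>+w\<in>{0<..<T}. ennpowr (G w) p \<partial>lborel)"
  proof (rule nn_integral_mono)
    fix w :: real
    have "ennreal (c powr p) \<le> ennpowr (G w) p" if "0 < w" "w < N"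
      using ennpowr_mono[OF assms(5)[OF that], of p] assms by simp
    then show "ennreal (c powr p) * indicator {0<..<N} w \<le> ennpowr (G w) p * indicator {0<..<T} w"
      using assms by (auto simp: indicator_def)
  qed
  finally show ?thesis .
qed

text \<open>Turns a norm inequality along a family of test functions into an inequality between
  exponents.\<close>

lemma powr_bounded_imp_nonpos:
  assumes "\<And>x. x\<^sub>0 \<le> x \<Longrightarrow> x powr e \<le> (K :: real)"
  shows "e \<le> 0"
proof (rule ccontr)
  assume "\<not> e \<le> 0"
  \<comment> \<open>At this point \<open>x powr e\<close> is at least
    \<open>\<bar>K\<bar> + 1\<close>, which exceeds \<open>K\<close>.\<close>
  define x where "x = max x\<^sub>0 ((\<bar>K\<bar> + 1) powr (1 / e))"
  have "\<bar>K\<bar> + 1 = ((\<bar>K\<bar> + 1) powr (1 / e)) powr e"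
    using \<open>\<not> e \<le> 0\<close> by (simp add: powr_powr)
  also have "\<dots> \<le> x powr e"
    using \<open>\<not> e \<le> 0\<close> by (intro powr_mono2) (auto simp: x_def)
  also have "\<dots> \<le> K" by (intro assms) (simp add: x_def)
  finally show False by simp
qed

section \<open>Necessity\<close>

lemma rearrangement_indicator_ge:
  assumes "0 \<le> w" "w < N"
  shows "ennreal 1 \<le> rearrangement (test_fun 0 N) w"
  using rearrangement_test_fun_ge[of 0 w "(w + N) / 2" N] assms
  by (simp add: trunc_power_def)

text \<open>The length \<open>b powr r\<close> is chosen so that for \<open>x > b\<close> the inner
  integral sees the whole indicator, and \<open>R_op\<close> has the tail
  \<open>(b powr r / x) powr (1 / p)\<close>. Up to \<open>T\<close> this is bounded below by its
  value at \<open>T\<close>.\<close>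

lemma R_op_indicator_ge:
  assumes "0 < p" "p < q" "0 < b" "b < x" "x \<le> T"
  defines "r \<equiv> q / (q - p)"
  shows "ennreal ((b powr r / T) powr (1 / p)) \<le> e2ennreal \<bar>R_op p q (test_fun 0 (b powr r)) x\<bar>"
proof -
  have r: "0 < r" using assms by (simp add: r_def)
  have "ennreal (1 powr p * b powr r) \<le>
      (\<integral>\<^sup>+w\<in>{0<..<x powr r}. ennpowr (rearrangement (test_fun 0 (b powr r)) w) p \<partial>lborel)"
    using assms(1-5) r
    by (intro nn_integral_ennpowr_ge_const rearrangement_indicator_ge powr_mono2) auto
  then have "ennreal ((b powr r / x) powr (1 / p)) \<le> hardy p r (rearrangement (test_fun 0 (b powr r))) x"
    using assms(1-5) by (intro hardy_lower) auto
  moreover have "(b powr r / T) powr (1 / p) \<le> (b powr r / x) powr (1 / p)"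
    using assms(1-5) by (intro powr_mono2 divide_left_mono) auto
  ultimately show ?thesis
    by (auto simp: r_def intro: order_trans ennreal_leI)
qed

text \<open>Testing on indicators gives an inequality with two free parameters \<open>b < T\<close>.
  Fixing \<open>T / b\<close> and letting \<open>b\<close> tend to infinity and to 0 forces the
  scaling relation; fixing \<open>b\<close> and letting \<open>T\<close> grow forces the bound on
  \<open>\<alpha>\<^sub>2\<close>.\<close>

lemma R_op_bounded_imp_exponents:
  assumes "1 \<le> r\<^sub>1" "1 \<le> r\<^sub>2" "1 \<le> s\<^sub>1" "1 \<le> s\<^sub>2" "r\<^sub>1 < \<infinity> \<or> s\<^sub>1 = \<infinity>" "r\<^sub>2 < \<infinity> \<or> s\<^sub>2 = \<infinity>"
    and "1 < p" "p < q"
    and bounded: "lorentz_bounded (R_op p q) r\<^sub>1 s\<^sub>1 r\<^sub>2 s\<^sub>2"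
  defines "r \<equiv> q / (q - p)" and "\<alpha>\<^sub>1 \<equiv> real_of_ereal (1 / r\<^sub>1)" and "\<alpha>\<^sub>2 \<equiv> real_of_ereal (1 / r\<^sub>2)"
  shows "\<alpha>\<^sub>1 = 1 / q + \<alpha>\<^sub>2 / r" "\<alpha>\<^sub>2 \<le> 1 / p"
proof -
  have r: "1 < r" using assms by (simp add: r_def field_simps)
  have rmeas: "R_op p q g \<in> borel_measurable halfline" for g
    using r by (intro R_op_measurable) (simp add: r_def)
  have \<alpha>2: "0 \<le> \<alpha>\<^sub>2" unfolding \<alpha>\<^sub>2_def by (intro real_of_ereal_inverse_nonneg assms)
  obtain C where C: "0 < C" "\<And>g. g \<in> meas_funs \<Longrightarrow>
      lorentz_norm r\<^sub>2 s\<^sub>2 (R_op p q g) \<le> ennreal C * lorentz_norm r\<^sub>1 s\<^sub>1 g"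
    using bounded unfolding lorentz_bounded_def by auto
  obtain \<kappa> where \<kappa>: "0 < \<kappa>"
    "\<And>f u v c. f \<in> borel_measurable halfline \<Longrightarrow> 0 \<le> u \<Longrightarrow> u < v \<Longrightarrow> 0 \<le> c \<Longrightarrow>
      (\<And>x. u < x \<Longrightarrow> x < v \<Longrightarrow> ennreal c \<le> e2ennreal \<bar>f x\<bar>) \<Longrightarrow>
      ennreal (\<kappa> * (v - u) powr \<alpha>\<^sub>2 * c) \<le> lorentz_norm r\<^sub>2 s\<^sub>2 f"
    using lorentz_norm_lower[OF assms(2,4,6)] unfolding \<alpha>\<^sub>2_def by blast
  obtain K where K: "0 < K" "\<And>N. 0 < N \<Longrightarrow>
      lorentz_norm r\<^sub>1 s\<^sub>1 (test_fun 0 N) \<le> ennreal (K * N powr \<alpha>\<^sub>1)"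
    using lorentz_norm_indicator_le[OF assms(1,3,5)] unfolding \<alpha>\<^sub>1_def by blast
  have main: "\<kappa> * (T - b) powr \<alpha>\<^sub>2 * (b powr r / T) powr (1 / p) \<le> C * (K * (b powr r) powr \<alpha>\<^sub>1)"
    if b: "0 < b" "b < T" for b T
  proof -
    let ?g = "test_fun 0 (b powr r)"
    have "ennreal (\<kappa> * (T - b) powr \<alpha>\<^sub>2 * (b powr r / T) powr (1 / p)) \<le> lorentz_norm r\<^sub>2 s\<^sub>2 (R_op p q ?g)"
      using b assms(7,8) unfolding r_def
      by (intro \<kappa>(2) rmeas R_op_indicator_ge) auto
    also have "\<dots> \<le> ennreal C * lorentz_norm r\<^sub>1 s\<^sub>1 ?g"
      by (intro C test_fun_meas_funs)
    also have "\<dots> \<le> ennreal C * ennreal (K * (b powr r) powr \<alpha>\<^sub>1)"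
      using b by (intro mult_left_mono K) auto
    also have "\<dots> = ennreal (C * (K * (b powr r) powr \<alpha>\<^sub>1))"
      using C(1) K(1) by (intro ennreal_mult[symmetric]) auto
    finally show ?thesis using C(1) K(1) by (subst (asm) ennreal_le_iff) auto
  qed
  \<comment> \<open>The net power of \<open>b\<close> in \<open>main\<close> for
    \<open>T = 2 * b\<close>.\<close>
  define e where "e = \<alpha>\<^sub>2 + (r - 1) / p - r * \<alpha>\<^sub>1"
  have e_bound: "b powr e \<le> C * K / \<kappa> * 2 powr (1 / p)" if b: "0 < b" for b
  proof -
    have half: "b powr r / (2 * b) = b powr (r - 1) / 2"
      using b by (simp add: powr_diff)
    have "(b powr r / (2 * b)) powr (1 / p) = b powr ((r - 1) / p) / 2 powr (1 / p)"
      unfolding half by (simp add: powr_divide powr_powr)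
    then have "\<kappa> * (b powr \<alpha>\<^sub>2 * b powr ((r - 1) / p)) / 2 powr (1 / p) \<le> C * K * b powr (r * \<alpha>\<^sub>1)"
      using main[of b "2 * b"] b by (simp add: powr_powr mult.assoc)
    then have "\<kappa> * (b powr \<alpha>\<^sub>2 * b powr ((r - 1) / p)) / 2 powr (1 / p) * b powr (- (r * \<alpha>\<^sub>1))
        \<le> C * K * b powr (r * \<alpha>\<^sub>1) * b powr (- (r * \<alpha>\<^sub>1))"
      by (rule mult_right_mono) simp
    moreover have "b powr (r * \<alpha>\<^sub>1) * b powr (- (r * \<alpha>\<^sub>1)) = 1"
      using b by (simp add: powr_add[symmetric])
    moreover have "b powr e = b powr \<alpha>\<^sub>2 * b powr ((r - 1) / p) * b powr (- (r * \<alpha>\<^sub>1))"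
      by (simp add: e_def powr_add[symmetric])
    ultimately have "\<kappa> * b powr e / 2 powr (1 / p) \<le> C * K"
      by (simp add: mult.assoc)
    then show ?thesis using \<kappa> by (simp add: field_simps)
  qed
  have "e \<le> 0"
    by (rule powr_bounded_imp_nonpos[of 1], rule e_bound) simp
  \<comment> \<open>Small \<open>b\<close> is reached as \<open>b = 1 / x\<close> with
    \<open>x\<close> large.\<close>
  moreover have "- e \<le> 0"
  proof (rule powr_bounded_imp_nonpos[of 1])
    fix x :: real assume "1 \<le> x"
    then show "x powr - e \<le> C * K / \<kappa> * 2 powr (1 / p)"
      using e_bound[of "1 / x"] by (simp add: powr_divide powr_minus divide_simps)
  qed
  ultimately have "r * \<alpha>\<^sub>1 = \<alpha>\<^sub>2 + (r - 1) / p" by (simp add: e_def)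
  moreover have "(r - 1) / p = r / q" using assms(7,8) by (simp add: r_def field_simps)
  ultimately have "r * \<alpha>\<^sub>1 = r * (1 / q + \<alpha>\<^sub>2 / r)" using r by (simp add: distrib_left)
  then show "\<alpha>\<^sub>1 = 1 / q + \<alpha>\<^sub>2 / r" using r by (simp only: mult_cancel_left) auto
  \<comment> \<open>Now \<open>b = 1\<close> and \<open>T\<close> grows; \<open>T \<ge> 2\<close>
    gives \<open>T - 1 \<ge> T / 2\<close>.\<close>
  have "\<alpha>\<^sub>2 - 1 / p \<le> 0"
  proof (rule powr_bounded_imp_nonpos[of 2])
    fix T :: real assume T: "2 \<le> T"
    have "T powr (\<alpha>\<^sub>2 - 1 / p) = 2 powr \<alpha>\<^sub>2 * ((T / 2) powr \<alpha>\<^sub>2 * (1 / T) powr (1 / p))"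
      using T by (simp add: powr_diff powr_divide)
    also have "\<dots> \<le> 2 powr \<alpha>\<^sub>2 * ((T - 1) powr \<alpha>\<^sub>2 * (1 / T) powr (1 / p))"
      using T \<alpha>2 by (intro mult_left_mono mult_right_mono powr_mono2) auto
    also have "\<dots> \<le> 2 powr \<alpha>\<^sub>2 * (C * K / \<kappa>)"
      using main[of 1 T] T \<kappa> by (intro mult_left_mono) (auto simp: field_simps)
    finally show "T powr (\<alpha>\<^sub>2 - 1 / p) \<le> 2 powr \<alpha>\<^sub>2 * (C * K / \<kappa>)" .
  qed
  then show "\<alpha>\<^sub>2 \<le> 1 / p" by simp
qed

text \<open>One fixed function suffices: for the indicator of \<open>(0, 1)\<close> the tail of
  \<open>R_op\<close> is of order \<open>t powr (- 1 / p)\<close>. For a finite second index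
  \<open>b\<close>, its part on \<open>(1, N)\<close> already contributes a norm of order
  \<open>(ln N) powr (1 / b)\<close>, which is unbounded.\<close>

lemma R_op_bounded_imp_weak:
  assumes "1 \<le> r\<^sub>1" "1 \<le> s\<^sub>1" "1 \<le> s\<^sub>2" "r\<^sub>1 < \<infinity> \<or> s\<^sub>1 = \<infinity>"
    and "1 < p" "p < q"
    and bounded: "lorentz_bounded (R_op p q) r\<^sub>1 s\<^sub>1 (ereal p) s\<^sub>2"
  shows "s\<^sub>2 = \<infinity>"
proof (rule ccontr)
  assume "s\<^sub>2 \<noteq> \<infinity>"
  then obtain b where b: "s\<^sub>2 = ereal b" "1 \<le> b"
    using assms by (cases s\<^sub>2) (auto simp: one_ereal_def)
  obtain C where C: "0 < C" "\<And>g. g \<in> meas_funs \<Longrightarrow>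
      lorentz_norm (ereal p) s\<^sub>2 (R_op p q g) \<le> ennreal C * lorentz_norm r\<^sub>1 s\<^sub>1 g"
    using bounded unfolding lorentz_bounded_def by auto
  obtain K where K: "0 < K" "\<And>N. 0 < N \<Longrightarrow>
      lorentz_norm r\<^sub>1 s\<^sub>1 (test_fun 0 N) \<le> ennreal (K * N powr real_of_ereal (1 / r\<^sub>1))"
    using lorentz_norm_indicator_le[OF assms(1,2,4)] by blast
  let ?f = "R_op p q (test_fun 0 1)"
  have f: "?f \<in> borel_measurable halfline"
    using assms(5,6) by (intro R_op_measurable) auto
  \<comment> \<open>From the interval \<open>(1, 3 * t)\<close>: it is longer than \<open>t\<close>,
    and on it \<open>R_op\<close> is at least \<open>(1 / (3 * t)) powr (1 / p)\<close>.\<close>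
  define c :: real where "c = (1 / 3) powr (1 / p)"
  have lower: "ennreal (c * t powr - (1 / p)) \<le> rearrangement ?f t" if t: "1 < t" for t
  proof -
    have "ennreal (c * t powr - (1 / p)) = ennreal ((1 / (3 * t)) powr (1 / p))"
      using t by (simp add: c_def powr_divide powr_minus powr_mult divide_simps)
    also have "\<dots> \<le> rearrangement ?f t"
      using R_op_indicator_ge[of p q 1 _ "3 * t"] assms(5,6) t
      by (intro rearrangement_lower[OF f, of 1 "3 * t"]) auto
    finally show ?thesis .
  qed
  have "L powr (1 / b) \<le> C * K / c" if L: "0 \<le> L" for L
  proof -
    have "ennreal (c * ln (exp L) powr (1 / b)) \<le> lorentz_norm (ereal p) (ereal b) ?f"
      using assms(5) b L lower by (intro lorentz_norm_log_lower) (auto simp: c_def)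
    also have "\<dots> \<le> ennreal C * lorentz_norm r\<^sub>1 s\<^sub>1 (test_fun 0 1)"
      using C(2)[OF test_fun_meas_funs] b by auto
    also have "\<dots> \<le> ennreal C * ennreal K"
      using K(2)[of 1] by (intro mult_left_mono) auto
    also have "\<dots> = ennreal (C * K)" using C(1) K(1) by (simp add: ennreal_mult)
    finally have "c * L powr (1 / b) \<le> C * K" using C(1) K(1) by (subst (asm) ennreal_le_iff) auto
    then show ?thesis by (simp add: c_def field_simps)
  qed
  then have "1 / b \<le> 0" by (rule powr_bounded_imp_nonpos)
  then show False using b by (simp add: divide_le_0_iff)
qed

text \<open>For \<open>L \<ge> 1\<close> the affine expression is at most
  \<open>(1 + A + B) * L\<close>, so dividing by \<open>L powr \<sigma>\<close> leaves a bounded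
  power of \<open>L\<close>. In the applications \<open>A + B * L\<close> is the logarithm of the
  cut-off of a test function.\<close>

lemma log_growth_imp_le:
  fixes \<kappa> A B \<sigma> e K :: real
  assumes "0 < \<kappa>" "0 \<le> A" "0 \<le> \<sigma>"
    and "\<And>L. 1 \<le> L \<Longrightarrow> \<kappa> * L powr e \<le> K * (1 + (A + B * L)) powr \<sigma>" and "0 \<le> B" "0 \<le> K"
  shows "e \<le> \<sigma>"
proof -
  have "L powr (e - \<sigma>) \<le> K * (1 + A + B) powr \<sigma> / \<kappa>" if L: "1 \<le> L" for L
  proof -
    have "\<kappa> * L powr e \<le> K * (1 + (A + B * L)) powr \<sigma>" by (rule assms(4)[OF L])
    also have "\<dots> \<le> K * ((1 + A + B) * L) powr \<sigma>"
    proof (intro mult_left_mono powr_mono2)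
      show "1 + (A + B * L) \<le> (1 + A + B) * L"
        using L mult_left_mono[of 1 L A] assms by (simp add: algebra_simps)
    qed (use assms L in auto)
    also have "\<dots> = K * (1 + A + B) powr \<sigma> * L powr \<sigma>"
      using assms L by (simp add: powr_mult)
    finally have "\<kappa> * L powr e / L powr \<sigma> \<le> K * (1 + A + B) powr \<sigma>"
      using L by (simp add: divide_le_eq)
    then show ?thesis using assms(1) by (simp add: powr_diff field_simps)
  qed
  then have "e - \<sigma> \<le> 0" by (rule powr_bounded_imp_nonpos)
  then show ?thesis by simp
qed

text \<open>By the scaling relation \<open>R_op\<close> sends decay of order
  \<open>\<alpha>\<^sub>1\<close> to decay of order at most \<open>\<alpha>\<^sub>2\<close>, the
  critical rate of the target space. Both norms are then governed by powers of the logarithm of the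
  cut-off, and comparing these powers gives the claim.\<close>

lemma R_op_bounded_imp_s_le:
  assumes "1 \<le> r\<^sub>1" "1 \<le> r\<^sub>2" "1 \<le> s\<^sub>1" "r\<^sub>1 < \<infinity>" "1 \<le> b"
    and "1 < p" "p < q"
    and bounded: "lorentz_bounded (R_op p q) r\<^sub>1 s\<^sub>1 r\<^sub>2 (ereal b)"
  defines "r \<equiv> q / (q - p)" and "\<alpha>\<^sub>1 \<equiv> real_of_ereal (1 / r\<^sub>1)" and "\<alpha>\<^sub>2 \<equiv> real_of_ereal (1 / r\<^sub>2)"
  assumes \<alpha>1: "\<alpha>\<^sub>1 = 1 / q + \<alpha>\<^sub>2 / r"
  shows "1 / b \<le> real_of_ereal (1 / s\<^sub>1)"
proof -
  define \<sigma> where "\<sigma> = real_of_ereal (1 / s\<^sub>1)"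
  have r: "1 < r" using assms by (simp add: r_def field_simps)
  have \<alpha>20: "0 \<le> \<alpha>\<^sub>2" unfolding \<alpha>\<^sub>2_def by (intro real_of_ereal_inverse_nonneg assms)
  have \<alpha>10: "0 \<le> \<alpha>\<^sub>1" unfolding \<alpha>\<^sub>1_def by (intro real_of_ereal_inverse_nonneg assms)
  have \<sigma>0: "0 \<le> \<sigma>" unfolding \<sigma>_def by (intro real_of_ereal_inverse_nonneg assms)
  obtain C where C: "0 < C" "\<And>g. g \<in> meas_funs \<Longrightarrow>
      lorentz_norm r\<^sub>2 (ereal b) (R_op p q g) \<le> ennreal C * lorentz_norm r\<^sub>1 s\<^sub>1 g"
    using bounded unfolding lorentz_bounded_def by auto
  obtain K where K: "0 < K" "\<And>N. 1 \<le> N \<Longrightarrow>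
      lorentz_norm r\<^sub>1 s\<^sub>1 (test_fun \<alpha>\<^sub>1 N) \<le> ennreal (K * (1 + ln N) powr \<sigma>)"
    using lorentz_norm_trunc_power_le[OF assms(1,4,3)] unfolding \<alpha>\<^sub>1_def \<sigma>_def by blast
  \<comment> \<open>The power of \<open>x\<close> that arises when the rearrangement is bounded
    below on \<open>(0, x powr r)\<close> by the value of the test function at
    \<open>x powr r\<close>.\<close>
  have expo: "(r - 1) / p - r * \<alpha>\<^sub>1 = - \<alpha>\<^sub>2"
  proof -
    have "(r - 1) / p = r / q" using assms(6,7) by (simp add: r_def field_simps)
    then show ?thesis unfolding \<alpha>1 using r by (simp add: distrib_left)
  qed
  \<comment> \<open>The rearrangement at \<open>t\<close> is again estimated through the interval
    \<open>(1, 3 * t)\<close>, hence the 3.\<close>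
  define c :: real where "c = 3 powr - \<alpha>\<^sub>2"
  have growth: "c * L powr (1 / b) \<le> (C * K) * (1 + (r * ln 3 + r * L)) powr \<sigma>" if L: "1 \<le> L" for L
  proof -
    \<comment> \<open>The cut-off lies beyond \<open>x powr r\<close> for every positive
      \<open>x < 3 * exp L\<close>, and its logarithm is affine in \<open>L\<close>.\<close>
    define N where "N = (3 * exp L) powr r"
    have "1 \<le> exp L" using L by simp
    then have N1: "1 \<le> N" unfolding N_def using r by (intro ge_one_powr_ge_zero) linarith+
    have lnN: "ln N = r * ln 3 + r * L"
      by (simp add: N_def ln_powr ln_mult distrib_left)
    let ?f = "R_op p q (test_fun \<alpha>\<^sub>1 N)"
    have f: "?f \<in> borel_measurable halfline"
      using assms(6,7) by (intro R_op_measurable) auto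
    have R_ge: "ennreal (x powr - \<alpha>\<^sub>2) \<le> e2ennreal \<bar>?f x\<bar>" if x: "1 < x" "x < 3 * exp L" for x
    proof -
      have xN: "x powr r < N" unfolding N_def using x r by (intro powr_less_mono2) auto
      have x1: "1 \<le> x powr r" using x r by (intro ge_one_powr_ge_zero) auto
      have "trunc_power \<alpha>\<^sub>1 N (x powr r) = x powr (- (r * \<alpha>\<^sub>1))"
      proof -
        have "(x powr r) powr - \<alpha>\<^sub>1 \<le> 1" using powr_mono[of "- \<alpha>\<^sub>1" 0 "x powr r"] x1 \<alpha>10 x by simp
        then show ?thesis using xN by (simp add: trunc_power_def powr_powr)
      qed
      then have "ennreal ((x powr (- (r * \<alpha>\<^sub>1))) powr p * x powr r) \<le>
          (\<integral>\<^sup>+w\<in>{0<..<x powr r}. ennpowr (rearrangement (test_fun \<alpha>\<^sub>1 N) w) p \<partial>lborel)"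
        using assms(6) rearrangement_test_fun_ge[OF \<alpha>10, of _ "x powr r" N]
        by (intro nn_integral_ennpowr_ge_const) auto
      then have "ennreal (((x powr (- (r * \<alpha>\<^sub>1))) powr p * x powr r / x) powr (1 / p)) \<le>
          hardy p r (rearrangement (test_fun \<alpha>\<^sub>1 N)) x"
        using assms(6) x by (intro hardy_lower) auto
      also have "((x powr (- (r * \<alpha>\<^sub>1))) powr p * x powr r / x) powr (1 / p) = x powr - \<alpha>\<^sub>2"
      proof -
        have "(x powr (- (r * \<alpha>\<^sub>1))) powr p * x powr r / x = x powr ((- (r * \<alpha>\<^sub>1)) * p + r - 1)"
          unfolding powr_powr using x by (simp add: powr_add powr_diff powr_minus divide_simps)
        moreover have "((- (r * \<alpha>\<^sub>1)) * p + r - 1) * (1 / p) = (r - 1) / p - r * \<alpha>\<^sub>1"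
          using assms(6) by (simp add: field_simps)
        ultimately show ?thesis by (simp only: powr_powr expo)
      qed
      finally show ?thesis by (simp add: r_def)
    qed
    have lower: "ennreal (c * t powr - \<alpha>\<^sub>2) \<le> rearrangement ?f t" if t: "1 < t" "t < exp L" for t
    proof -
      have "c * t powr - \<alpha>\<^sub>2 = (3 * t) powr - \<alpha>\<^sub>2" using t by (simp add: c_def powr_mult)
      moreover have "ennreal ((3 * t) powr - \<alpha>\<^sub>2) \<le> rearrangement ?f t"
      proof (rule rearrangement_lower[OF f, of 1 "3 * t"])
        fix x assume x: "1 < x" "x < 3 * t"
        have "(3 * t) powr - \<alpha>\<^sub>2 \<le> x powr - \<alpha>\<^sub>2" using x \<alpha>20 by (intro powr_mono2') auto
        then have "ennreal ((3 * t) powr - \<alpha>\<^sub>2) \<le> ennreal (x powr - \<alpha>\<^sub>2)" by (rule ennreal_leI)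
        also have "\<dots> \<le> e2ennreal \<bar>?f x\<bar>" using x t by (intro R_ge) auto
        finally show "ennreal ((3 * t) powr - \<alpha>\<^sub>2) \<le> e2ennreal \<bar>?f x\<bar>" .
      qed (use t in auto)
      ultimately show ?thesis by simp
    qed
    have "ennreal (c * ln (exp L) powr (1 / b)) \<le> lorentz_norm r\<^sub>2 (ereal b) ?f"
      using assms(2,5) L lower unfolding \<alpha>\<^sub>2_def
      by (intro lorentz_norm_log_lower) (auto simp: c_def)
    also have "\<dots> \<le> ennreal C * lorentz_norm r\<^sub>1 s\<^sub>1 (test_fun \<alpha>\<^sub>1 N)"
      by (intro C test_fun_meas_funs)
    also have "\<dots> \<le> ennreal C * ennreal (K * (1 + ln N) powr \<sigma>)"
      using N1 by (intro mult_left_mono K) auto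
    also have "\<dots> = ennreal ((C * K) * (1 + (r * ln 3 + r * L)) powr \<sigma>)"
      using C(1) K(1) by (simp add: ennreal_mult[symmetric] lnN mult.assoc)
    finally show ?thesis using C(1) K(1) by (subst (asm) ennreal_le_iff) auto
  qed
  show ?thesis
    unfolding \<sigma>_def[symmetric]
    by (rule log_growth_imp_le[OF _ _ \<sigma>0 growth]) (use C(1) K(1) r in \<open>simp_all add: c_def\<close>)
qed

text \<open>For \<open>r\<^sub>1 = p\<close> the \<open>p\<close>-th power of the test function
  decays like \<open>1 / w\<close>, so the inner integral itself grows like the logarithm of the
  cut-off. This makes even the weak norm of the image grow, with exponent
  \<open>1 / p\<close>.\<close>

lemma R_op_bounded_imp_s_le_p:
  assumes "1 \<le> s\<^sub>1" "1 < p" "p < q"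
    and bounded: "lorentz_bounded (R_op p q) (ereal p) s\<^sub>1 (ereal p) \<infinity>"
  shows "1 / p \<le> real_of_ereal (1 / s\<^sub>1)"
proof -
  define r where "r = q / (q - p)"
  have r: "1 < r" using assms by (simp add: r_def field_simps)
  define \<sigma> where "\<sigma> = real_of_ereal (1 / s\<^sub>1)"
  have \<sigma>0: "0 \<le> \<sigma>" unfolding \<sigma>_def by (intro real_of_ereal_inverse_nonneg assms)
  have p1: "1 \<le> ereal p" "ereal p < \<infinity>" using assms by auto
  obtain C where C: "0 < C" "\<And>g. g \<in> meas_funs \<Longrightarrow>
      lorentz_norm (ereal p) \<infinity> (R_op p q g) \<le> ennreal C * lorentz_norm (ereal p) s\<^sub>1 g"
    using bounded unfolding lorentz_bounded_def by auto
  obtain K where K: "0 < K" "\<And>N. 1 \<le> N \<Longrightarrow>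
      lorentz_norm (ereal p) s\<^sub>1 (test_fun (1 / p) N) \<le> ennreal (K * (1 + ln N) powr \<sigma>)"
    using lorentz_norm_trunc_power_le[OF p1 assms(1)] unfolding \<sigma>_def real_of_ereal_inverse by blast
  obtain \<kappa> where \<kappa>: "0 < \<kappa>"
    "\<And>f u v c. f \<in> borel_measurable halfline \<Longrightarrow> 0 \<le> u \<Longrightarrow> u < v \<Longrightarrow> 0 \<le> c \<Longrightarrow>
      (\<And>x. u < x \<Longrightarrow> x < v \<Longrightarrow> ennreal c \<le> e2ennreal \<bar>f x\<bar>) \<Longrightarrow>
      ennreal (\<kappa> * (v - u) powr (1 / p) * c) \<le> lorentz_norm (ereal p) \<infinity> f"
    using lorentz_norm_lower[of "ereal p" \<infinity>] p1 unfolding real_of_ereal_inverse by auto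
  have growth: "(\<kappa> * (1 / 4) powr (1 / p)) * L powr (1 / p) \<le> (C * K) * (1 + (ln 2 + 1 * L)) powr \<sigma>" if L: "1 \<le> L" for L
  proof -
    \<comment> \<open>The factor 2 keeps \<open>2 * w\<close> below the cut-off for
      \<open>w < exp L\<close>.\<close>
    define N where "N = 2 * exp L"
    have "1 \<le> exp L" using L by simp
    then have N1: "1 \<le> N" unfolding N_def by linarith
    have lnN: "ln N = ln 2 + L" by (simp add: N_def ln_mult)
    let ?G = "rearrangement (test_fun (1 / p) N)" and ?f = "R_op p q (test_fun (1 / p) N)"
    \<comment> \<open>For \<open>x > b\<close> the inner integral covers all of
      \<open>(0, N)\<close>. The interval \<open>(b, 2 * b)\<close> then contributes
      \<open>b powr (1 / p)\<close> to the weak norm, which cancels the \<open>b\<close> in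
      \<open>R_ge\<close>.\<close>
    define b where "b = N powr (1 / r)"
    have b: "0 < b" using N1 by (simp add: b_def)
    have f: "?f \<in> borel_measurable halfline"
      using assms(2,3) by (intro R_op_measurable) auto
    have R_ge: "ennreal ((L / (4 * b)) powr (1 / p)) \<le> e2ennreal \<bar>?f x\<bar>" if x: "b < x" "x < 2 * b" for x
    proof -
      have "N = b powr r" using N1 r by (simp add: b_def powr_powr)
      also have "\<dots> \<le> x powr r" using x b r by (intro powr_mono2) auto
      finally have Nx: "N \<le> x powr r" .
      \<comment> \<open>The factor \<open>1 / 2\<close> comes from bounding the rearrangement at
        \<open>w\<close> below by the test function at \<open>2 * w\<close>.\<close>
      have "ennreal (L / 2) = ennreal (1 / 2 * ln (exp L))" by simp
      also have "\<dots> = ennreal (1 / 2) * ennreal (ln (exp L))"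
        using L by (intro ennreal_mult) auto
      also have "\<dots> = (\<integral>\<^sup>+w. ennreal (1 / 2) * (ennreal (w powr - 1) * indicator {1<..<exp L} w) \<partial>lborel)"
        using L by (subst nn_integral_inverse[symmetric]) (auto simp: nn_integral_cmult)
      also have "\<dots> \<le> (\<integral>\<^sup>+w\<in>{0<..<x powr r}. ennpowr (?G w) p \<partial>lborel)"
      proof (rule nn_integral_mono)
        fix w :: real
        show "ennreal (1 / 2) * (ennreal (w powr - 1) * indicator {1<..<exp L} w) \<le> ennpowr (?G w) p * indicator {0<..<x powr r} w"
        proof (cases "w \<in> {1<..<exp L}")
          case True
          then have w: "1 < w" "2 * w < N" by (auto simp: N_def)
          have "(2 * w) powr - (1 / p) \<le> 1"
            using powr_mono[of "- (1 / p)" 0 "2 * w"] w assms(2) by simp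
          then have tp: "trunc_power (1 / p) N (2 * w) = (2 * w) powr - (1 / p)"
            using w by (simp add: trunc_power_def)
          have "ennreal ((2 * w) powr - (1 / p)) \<le> ?G w"
            using rearrangement_test_fun_ge[of "1 / p" w "2 * w" N] w assms(2) unfolding tp by auto
          then have "ennpowr (ennreal ((2 * w) powr - (1 / p))) p \<le> ennpowr (?G w) p"
            using assms(2) by (intro ennpowr_mono) auto
          then have "ennreal (1 / 2 * w powr - 1) \<le> ennpowr (?G w) p"
            unfolding ennpowr_ennreal[OF powr_ge_zero] powr_powr
            using assms(2) w by (simp add: powr_minus field_simps)
          then have "ennreal (1 / 2) * ennreal (w powr - 1) \<le> ennpowr (?G w) p"
            by (subst ennreal_mult[symmetric]) auto
          moreover have "w < x powr r" using w Nx by linarith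
          ultimately show ?thesis using True by simp
        qed simp
      qed
      finally have "ennreal ((L / 2 / x) powr (1 / p)) \<le> hardy p r ?G x"
        using assms(2) x b L by (intro hardy_lower) auto
      moreover have "(L / (4 * b)) powr (1 / p) \<le> (L / 2 / x) powr (1 / p)"
        using x b L assms(2) by (intro powr_mono2) (auto simp: field_simps)
      ultimately show ?thesis
        by (auto simp: r_def intro: order_trans ennreal_leI)
    qed
    have "ennreal (\<kappa> * (2 * b - b) powr (1 / p) * (L / (4 * b)) powr (1 / p)) \<le> lorentz_norm (ereal p) \<infinity> ?f"
      using b R_ge by (intro \<kappa>(2) f) auto
    also have "\<kappa> * (2 * b - b) powr (1 / p) * (L / (4 * b)) powr (1 / p) = (\<kappa> * (1 / 4) powr (1 / p)) * L powr (1 / p)"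
      using b L by (simp add: powr_divide powr_mult)
    also have "lorentz_norm (ereal p) \<infinity> ?f \<le> ennreal C * lorentz_norm (ereal p) s\<^sub>1 (test_fun (1 / p) N)"
      by (intro C test_fun_meas_funs)
    also have "\<dots> \<le> ennreal C * ennreal (K * (1 + ln N) powr \<sigma>)"
      using N1 by (intro mult_left_mono K) auto
    also have "\<dots> = ennreal ((C * K) * (1 + (ln 2 + 1 * L)) powr \<sigma>)"
      using C(1) K(1) by (simp add: ennreal_mult[symmetric] lnN mult.assoc)
    finally show ?thesis using C(1) K(1) by (subst (asm) ennreal_le_iff) auto
  qed
  show ?thesis
    unfolding \<sigma>_def[symmetric]
    by (rule log_growth_imp_le[OF _ _ \<sigma>0 growth]) (use C(1) K(1) \<kappa>(1) in simp_all)
qed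

text \<open>The case \<open>s = \<infinity>\<close> is excluded, since its reciprocal is 0 while
  \<open>1 / b\<close> is positive.\<close>

lemma le_of_inverse_le:
  assumes "1 \<le> s" "0 < b" "1 / b \<le> real_of_ereal (1 / s)"
  shows "s \<le> ereal b"
  using assms by (cases s) (auto simp: one_ereal_def field_simps)

theorem theorem1p6:
  fixes r\<^sub>1 r\<^sub>2 s\<^sub>1 s\<^sub>2 :: ereal and p q r :: real
  assumes "1 \<le> r\<^sub>1" "1 \<le> r\<^sub>2" "1 \<le> s\<^sub>1" "1 \<le> s\<^sub>2"
    and "lorentz_admissible r\<^sub>1 s\<^sub>1"
    and "lorentz_admissible r\<^sub>2 s\<^sub>2"
    and "1 < p" and "p < q"
    and "r = q / (q - p)"
  shows "lorentz_bounded (R_op p q) r\<^sub>1 s\<^sub>1 r\<^sub>2 s\<^sub>2 \<longleftrightarrow>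
     (ereal p < r\<^sub>1 \<and> r\<^sub>1 < ereal q \<and> s\<^sub>1 \<le> s\<^sub>2 \<and> 1 / ereal q + 1 / (ereal r * r\<^sub>2) = 1 / r\<^sub>1) \<or>
     (r\<^sub>1 = ereal p \<and> r\<^sub>2 = ereal p \<and> s\<^sub>1 \<le> ereal p \<and> s\<^sub>2 = \<infinity>) \<or>
     (r\<^sub>1 = ereal q \<and> r\<^sub>2 = \<infinity> \<and> s\<^sub>2 = \<infinity>)"
    (is "?B \<longleftrightarrow> ?C")
proof
  assume ?C
  then show ?B using assms(1-4,7-9) by (intro R_op_bounded) auto
next
  assume B: ?B
  \<comment> \<open>Admissibility enters in this form: an infinite first index comes with an
    infinite second one.\<close>
  have adm: "r\<^sub>1 < \<infinity> \<or> s\<^sub>1 = \<infinity>" "r\<^sub>2 < \<infinity> \<or> s\<^sub>2 = \<infinity>"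
    using assms(5,6) by (auto simp: lorentz_admissible_def one_ereal_def)
  define \<alpha>\<^sub>1 where "\<alpha>\<^sub>1 = real_of_ereal (1 / r\<^sub>1)"
  define \<alpha>\<^sub>2 where "\<alpha>\<^sub>2 = real_of_ereal (1 / r\<^sub>2)"
  have expo: "\<alpha>\<^sub>1 = 1 / q + \<alpha>\<^sub>2 / r" "\<alpha>\<^sub>2 \<le> 1 / p"
    using R_op_bounded_imp_exponents[OF assms(1-4) adm assms(7,8) B] assms(9)
    by (simp_all add: \<alpha>\<^sub>1_def \<alpha>\<^sub>2_def)
  have r: "1 < r" using assms(7,8) unfolding assms(9) by (simp add: field_simps)
  \<comment> \<open>The scaling relation sends \<open>\<alpha>\<^sub>2 = 1 / p\<close> to
    \<open>\<alpha>\<^sub>1 = 1 / p\<close>.\<close>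
  have pq: "1 / q + 1 / p / r = 1 / p" using assms(7,8) unfolding assms(9) by (simp add: field_simps)
  \<comment> \<open>The term \<open>1 / q\<close> keeps \<open>\<alpha>\<^sub>1\<close> positive, so
    \<open>r\<^sub>1\<close> is finite.\<close>
  have \<alpha>1pos: "0 < \<alpha>\<^sub>1"
  proof -
    have "0 \<le> \<alpha>\<^sub>2" unfolding \<alpha>\<^sub>2_def by (intro real_of_ereal_inverse_nonneg assms)
    then show ?thesis unfolding expo(1) using r assms(7,8) by (intro add_pos_nonneg) auto
  qed
  then obtain \<rho>\<^sub>1 where \<rho>1: "r\<^sub>1 = ereal \<rho>\<^sub>1" "\<alpha>\<^sub>1 = 1 / \<rho>\<^sub>1" "0 < \<rho>\<^sub>1"
    using assms(1) unfolding \<alpha>\<^sub>1_def by (cases r\<^sub>1) auto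
  show ?C
  \<comment> \<open>The position of \<open>\<alpha>\<^sub>2\<close> in the interval from 0 to
    \<open>1 / p\<close> selects the condition: 0 gives the third, \<open>1 / p\<close> the second,
    and the interior the first.\<close>
  proof (cases "r\<^sub>2 = \<infinity>")
    case True
    then have "1 / \<rho>\<^sub>1 = 1 / q" using expo(1) \<rho>1 by (simp add: \<alpha>\<^sub>2_def)
    then show ?thesis using True adm \<rho>1 by auto
  next
    case False
    then obtain \<rho>\<^sub>2 where \<rho>2: "r\<^sub>2 = ereal \<rho>\<^sub>2" "\<alpha>\<^sub>2 = 1 / \<rho>\<^sub>2" "0 < \<rho>\<^sub>2"
      using assms(2) unfolding \<alpha>\<^sub>2_def by (cases r\<^sub>2) (auto simp: one_ereal_def)
    show ?thesis
    proof (cases "\<alpha>\<^sub>2 = 1 / p")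
      case True
      then have r2: "r\<^sub>2 = ereal p" using \<rho>2 by simp
      have r1: "r\<^sub>1 = ereal p" using expo(1) pq True \<rho>1 by simp
      have s2: "s\<^sub>2 = \<infinity>"
        using R_op_bounded_imp_weak[OF assms(1,3,4) adm(1) assms(7,8)] B r2 by simp
      have "1 / p \<le> real_of_ereal (1 / s\<^sub>1)"
        using R_op_bounded_imp_s_le_p[OF assms(3,7,8)] B r1 r2 s2 by simp
      then have "s\<^sub>1 \<le> ereal p" using assms(3,7) by (intro le_of_inverse_le) auto
      then show ?thesis using r1 r2 s2 by simp
    next
      case False
      then have lt: "\<alpha>\<^sub>2 < 1 / p" using expo(2) by simp
      then have "\<alpha>\<^sub>2 / r < 1 / p / r" using r by (intro divide_strict_right_mono) auto
      then have "1 / \<rho>\<^sub>1 < 1 / p" using expo(1) pq \<rho>1 by linarith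
      then have "p < \<rho>\<^sub>1" using \<rho>1 assms(7) by (simp add: field_simps)
      moreover have "1 / q < 1 / \<rho>\<^sub>1"
      proof -
        have "0 < \<alpha>\<^sub>2 / r" using \<rho>2 r by simp
        then show ?thesis using expo(1) \<rho>1 by linarith
      qed
      then have "\<rho>\<^sub>1 < q" using \<rho>1 assms(7,8) by (simp add: field_simps)
      moreover have "s\<^sub>1 \<le> s\<^sub>2"
      proof (cases "s\<^sub>2 = \<infinity>")
        case False
        then obtain b where b: "s\<^sub>2 = ereal b" "1 \<le> b"
          using assms(4) by (cases s\<^sub>2) (auto simp: one_ereal_def)
        have "1 / b \<le> real_of_ereal (1 / s\<^sub>1)"
          using R_op_bounded_imp_s_le[OF assms(1-3) _ b(2) assms(7,8)] B b expo(1) \<rho>1(1)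
          by (simp add: \<alpha>\<^sub>1_def \<alpha>\<^sub>2_def assms(9))
        then show ?thesis unfolding b(1) using b assms(3) by (intro le_of_inverse_le) auto
      qed simp
      moreover have "1 / ereal q + 1 / (ereal r * r\<^sub>2) = 1 / r\<^sub>1"
        using ereal_inverse_eq_iff[of r\<^sub>1 r\<^sub>2 q r] assms(1,2,7,8) r expo(1) by (simp add: \<alpha>\<^sub>1_def \<alpha>\<^sub>2_def)
      ultimately show ?thesis using \<rho>1 by simp
    qed
  qed
qed

end
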